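(* The adjacency matrix (over $GF(2)$) of any meander graph is idempotent, i.e. $M^2=M$ over $GF(2)$.
   Context: An open meander of order $2n$ is a configuration in the plane consisting of an oriented simple curve and a segment $L$ of a straight line that cross transversally at exactly $2n$ points; two open meanders are equivalent if a homeomorphism of the plane maps one to the other. It is drawn so that $L$ is horizontal and oriented from left to right, and the curve is oriented so that at the leftmost intersection point it is directed from top to bottom. The intersection points are labelled $1,2,\dots,2n$ from left to right along $L$. Standing assumption (closing construction): let $a$ and $b$ be the initial and final points of $L$ (left and right ends, not intersection points), and $m$ and $m'$ the start and finish points of the curve (not on $L$). The curve can be closed up by two simple arcs, one joining $b$ to $m$ and one joining $m'$ to $a$, which meet $L$ and the curve only at these endpoints and which cross each other transversally at exactly one point, labelled $0$; thus one obtains a closed planar curve with crossings $0,1,\dots,2n$. The meandric permutation $\pi\in\mathfrak S_{2n}$ is given by: $\pi(k)$ is the label of the $k$th intersection point met when travelling along the curve from its start to its finish. Put $R_\pi=\{(i,j): 1\le i<j\le 2n,\ \pi(i)>\pi(j)\}$ and $\neg R_\pi=\{(i,j):1\le i<j\le 2n,\ \pi(i)<\pi(j)\}$. The meander graph $\Gamma(\mathscr M)$ of the meander $\mathscr M$ is the simple undirected graph with vertex set $\{0,1,\dots,2n\}$ and edge set $\{(0,i): 1\le i\le 2n\}\cup\neg R_\pi$. A meander graph is a graph of the form $\Gamma(\mathscr M)$. *)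

theory Defs
  imports "HOL-Analysis.Analysis" "HOL-Library.Z2" "Jordan_Normal_Form.Matrix"
begin

hide_const (open) Finite_Cartesian_Product.mat

text \<open>
  Curves are merely continuous and equivalence of meanders is by homeomorphisms, so transversality
  is taken in its topological sense: a local chart turns the two curves, in this order, into the
  horizontal and the vertical diameter of the open unit disc.
\<close>

definition crosses_transversally_at :: "complex set \<Rightarrow> complex set \<Rightarrow> complex \<Rightarrow> bool" where
  "crosses_transversally_at S T p \<longleftrightarrow>
     (\<exists>U h k. open U \<and> p \<in> U \<and> homeomorphism U (ball 0 1) h k \<and> h p = 0 \<and>
        h ` (U \<inter> S) = {z \<in> ball 0 1. Im z = 0} \<and>
        h ` (U \<inter> T) = {z \<in> ball 0 1. Re z = 0})"

definition intersection_points :: "complex \<Rightarrow> complex \<Rightarrow> (real \<Rightarrow> complex) \<Rightarrow> complex set" where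
  "intersection_points a b \<gamma> = path_image \<gamma> \<inter> closed_segment a b"

definition directed_downwards_at :: "complex \<Rightarrow> (real \<Rightarrow> complex) \<Rightarrow> real \<Rightarrow> bool" where
  "directed_downwards_at a \<gamma> t \<longleftrightarrow>
     (\<forall>\<^sub>F s in at_left t. Im (\<gamma> s) > Im a) \<and> (\<forall>\<^sub>F s in at_right t. Im (\<gamma> s) < Im a)"

text \<open>
  The segment \<open>L\<close> is \<open>closed_segment a b\<close>, horizontal and oriented from left to right; the oriented
  curve is the arc \<open>\<gamma>\<close>, with start \<open>m = pathstart \<gamma>\<close> and finish \<open>m' = pathfinish \<gamma>\<close>.
\<close>

definition open_meander :: "nat \<Rightarrow> complex \<Rightarrow> complex \<Rightarrow> (real \<Rightarrow> complex) \<Rightarrow> bool" where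
  "open_meander n a b \<gamma> \<longleftrightarrow>
     Im a = Im b \<and> Re a < Re b \<and> arc \<gamma> \<and>
     a \<notin> path_image \<gamma> \<and> b \<notin> path_image \<gamma> \<and>
     pathstart \<gamma> \<notin> closed_segment a b \<and> pathfinish \<gamma> \<notin> closed_segment a b \<and>
     finite (intersection_points a b \<gamma>) \<and> card (intersection_points a b \<gamma>) = 2 * n \<and>
     (\<forall>p \<in> intersection_points a b \<gamma>.
        crosses_transversally_at (closed_segment a b) (path_image \<gamma>) p) \<and>
     (\<forall>t \<in> {0..1}. is_arg_min Re (\<lambda>p. p \<in> intersection_points a b \<gamma>) (\<gamma> t)
        \<longrightarrow> directed_downwards_at a \<gamma> t)"

text \<open>
  The crossing point \<open>z\<close> of the two closing arcs \<open>\<beta>\<close> (from \<open>b\<close> to \<open>m\<close>) and \<open>\<alpha>\<close> (from \<open>m'\<close> to \<open>a\<close>)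
  is the one labelled \<open>0\<close>.
\<close>

definition closable :: "complex \<Rightarrow> complex \<Rightarrow> (real \<Rightarrow> complex) \<Rightarrow> bool" where
  "closable a b \<gamma> \<longleftrightarrow>
     (\<exists>\<beta> \<alpha> z. arc \<beta> \<and> pathstart \<beta> = b \<and> pathfinish \<beta> = pathstart \<gamma> \<and>
        arc \<alpha> \<and> pathstart \<alpha> = pathfinish \<gamma> \<and> pathfinish \<alpha> = a \<and>
        path_image \<beta> \<inter> (closed_segment a b \<union> path_image \<gamma>) = {b, pathstart \<gamma>} \<and>
        path_image \<alpha> \<inter> (closed_segment a b \<union> path_image \<gamma>) = {pathfinish \<gamma>, a} \<and>
        path_image \<beta> \<inter> path_image \<alpha> = {z} \<and>
        crosses_transversally_at (path_image \<beta>) (path_image \<alpha>) z)"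

definition intersection_label :: "complex \<Rightarrow> complex \<Rightarrow> (real \<Rightarrow> complex) \<Rightarrow> complex \<Rightarrow> nat" where
  "intersection_label a b \<gamma> p = card {q \<in> intersection_points a b \<gamma>. Re q \<le> Re p}"

text \<open>
  The list of intersection times is indexed from \<open>0\<close>, the intersection points are counted from \<open>1\<close>.
  As usual for permutations, the function is the identity outside \<open>{1..2 * n}\<close>.
\<close>

definition meandric_permutation ::
    "nat \<Rightarrow> complex \<Rightarrow> complex \<Rightarrow> (real \<Rightarrow> complex) \<Rightarrow> nat \<Rightarrow> nat" where
  "meandric_permutation n a b \<gamma> k =
     (if k \<in> {1..2 * n}
      then intersection_label a b \<gamma>
             (\<gamma> (sorted_list_of_set {t \<in> {0..1}. \<gamma> t \<in> closed_segment a b} ! (k - 1)))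
      else k)"

definition non_inversions :: "nat \<Rightarrow> (nat \<Rightarrow> nat) \<Rightarrow> (nat \<times> nat) set" where
  "non_inversions n \<pi> = {(i, j). 1 \<le> i \<and> i < j \<and> j \<le> 2 * n \<and> \<pi> i < \<pi> j}"

text \<open>A simple undirected graph is a pair of a vertex set and a set of two-element edges.\<close>

type_synonym ugraph = "nat set \<times> nat set set"

definition meander_graph_of :: "nat \<Rightarrow> complex \<Rightarrow> complex \<Rightarrow> (real \<Rightarrow> complex) \<Rightarrow> ugraph" where
  "meander_graph_of n a b \<gamma> =
     ({0..2 * n},
      {{0, i} |i. 1 \<le> i \<and> i \<le> 2 * n} \<union>
      {{i, j} |i j. (i, j) \<in> non_inversions n (meandric_permutation n a b \<gamma>)})"

definition is_meander_graph :: "ugraph \<Rightarrow> bool" where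
  "is_meander_graph G \<longleftrightarrow>
     (\<exists>n a b \<gamma>. open_meander n a b \<gamma> \<and> closable a b \<gamma> \<and> G = meander_graph_of n a b \<gamma>)"

text \<open>
  For graphs whose vertices are \<open>0, \<dots>, N - 1\<close>, so that vertices serve as row and column indices.
  The entries lie in the two-element field \<open>bit\<close>.
\<close>

definition adjacency_matrix :: "ugraph \<Rightarrow> bit mat" where
  "adjacency_matrix G =
     mat (card (fst G)) (card (fst G)) (\<lambda>(i, j). if {i, j} \<in> snd G then 1 else 0)"

end

theory Submission
  imports Defs
begin

text \<open>
  The crossing point \<open>z\<close> of the two closing arcs turns the meander into two simple loops based at \<open>z\<close>,
  one through the segment \<open>L\<close> and one through the curve. They cross at the \<open>2 * n\<close> points of the meander
  and touch at \<open>z\<close>. Label \<open>z\<close> both by \<open>0\<close> and by \<open>2 * n + 1\<close>, and let \<open>p\<close> be the meandric permutation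
  extended by \<open>p 0 = 0\<close> and \<open>p (2 * n + 1) = 2 * n + 1\<close>. The pieces (arches) of the second loop between
  consecutive meeting points, joining \<open>p k\<close> to \<open>p (k + 1)\<close>, lie alternately on the two sides of the
  first loop, by transversality and the Jordan curve theorem. Two arches on the same side do not cross:
  an arch together with the part of the first loop between its endpoints is a Jordan curve, and an arch
  with one endpoint on that part and the other one off it would have to change sides of this Jordan
  curve without meeting it (\<open>arch_not_crossed\<close>). The two arches that end at \<open>z\<close> need a separate
  argument with the corner at \<open>z\<close> (\<open>crossing_corner\<close>, \<open>first_last_order\<close>). Thus \<open>p\<close> is a noncrossing
  permutation (\<open>meandric_permutation_noncrossing\<close>).

  The rest is combinatorial. Let \<open>A\<close> be the adjacency matrix over \<open>GF(2)\<close> and \<open>D\<close> the set of times at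
  which a point under the \<open>i\<close>-th arch is visited. As arches of equal parity do not cross, \<open>D\<close> is a union
  of pairs \<open>{l, l + 1}\<close> with \<open>l\<close> of the parity of \<open>i\<close>. Hence an even number of points lies under each
  arch, \<open>p\<close> preserves parity, and all degrees of the graph are even, which is the claim \<open>A\<^sup>2 = A\<close> for row
  \<open>0\<close>. The rows \<open>i\<close> and \<open>i + 1\<close> of \<open>A\<close> differ by the indicator of \<open>D\<close>, apart from the columns \<open>i\<close> and
  \<open>i + 1\<close>; the pairs make it possible to compute the sum of the rows with index in \<open>D\<close>
  (\<open>sum_under\<close>), and the claim passes from row \<open>i\<close> to row \<open>i + 1\<close>.
\<close>

section \<open>Noncrossing permutations\<close>

definition strictly_between :: "nat \<Rightarrow> nat \<Rightarrow> nat \<Rightarrow> bool" where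
  "strictly_between x y u \<longleftrightarrow> min x y < u \<and> u < max x y"

text \<open>
  The adjacency matrix over \<open>GF(2)\<close> of the graph of non-inversions of \<open>p\<close>. If \<open>p\<close> is a
  permutation with \<open>p 0 = 0\<close>, then the vertex \<open>0\<close> is adjacent to all others. For a meandric permutation,
  the entries with indices in \<open>{0..2 * n}\<close> are thus those of the adjacency matrix of the meander graph, with
  the crossing \<open>0\<close> included.
\<close>

definition noninv :: "(nat \<Rightarrow> nat) \<Rightarrow> nat \<Rightarrow> nat \<Rightarrow> bit" where
  "noninv p l j = of_bool (l \<noteq> j \<and> (l < j \<longleftrightarrow> p l < p j))"

lemma of_nat_bit: "(of_nat x :: bit) = of_bool (odd x)"
  by (induction x) auto

text \<open>
  A permutation of \<open>{0..2 * n + 1}\<close> that fixes both ends, read as the order in which a curve visits the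
  points \<open>0, \<dots>, 2 * n + 1\<close> of a line. The \<open>k\<close>-th arch joins \<open>p k\<close> to \<open>p (Suc k)\<close>; arches of equal
  parity lie on the same side of the line, and the last assumption says that two of them do not cross.
\<close>

locale noncrossing_permutation =
  fixes n :: nat and p :: "nat \<Rightarrow> nat"
  assumes bij: "bij_betw p {0..2 * n + 1} {0..2 * n + 1}"
    and p_first: "p 0 = 0"
    and p_last: "p (2 * n + 1) = 2 * n + 1"
    and noncrossing: "\<And>k l. k \<le> 2 * n \<Longrightarrow> l \<le> 2 * n \<Longrightarrow> even (k + l) \<Longrightarrow> k \<noteq> l \<Longrightarrow>
      strictly_between (p k) (p (Suc k)) (p l) \<longleftrightarrow> strictly_between (p k) (p (Suc k)) (p (Suc l))"
begin

text \<open>The times at which a point under the \<open>k\<close>-th arch is visited.\<close>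

definition under :: "nat \<Rightarrow> nat set" where
  "under k = {l \<in> {0..2 * n + 1}. strictly_between (p k) (p (Suc k)) (p l)}"

lemma le_last: "l \<le> 2 * n + 1 \<Longrightarrow> p l \<le> 2 * n + 1"
  using bij by (auto simp: bij_betw_def)

lemma p_eq: "k \<le> 2 * n + 1 \<Longrightarrow> l \<le> 2 * n + 1 \<Longrightarrow> p k = p l \<longleftrightarrow> k = l"
  using bij by (auto simp: bij_betw_def inj_on_def)

text \<open>
  Since arches do not cross, the times in \<open>under k\<close> split into pairs \<open>l, Suc l\<close> of endpoints of arches of
  the parity of \<open>k\<close>; over \<open>GF(2)\<close> most terms then cancel.
\<close>

lemma under_pairs:
  fixes f :: "nat \<Rightarrow> 'a :: comm_monoid_add"
  assumes k: "k \<le> 2 * n"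
  shows "(\<Sum>l\<in>under k. f l) = (\<Sum>l | l \<in> under k \<and> even (k + l). f l + f (Suc l))"
proof -
  define P where "P = {l. l \<in> under k \<and> even (k + l)}"
  have fin: "finite (under k)" by (simp add: under_def)
  then have finP: "finite P" by (simp add: P_def)
  have not_ends: "0 \<notin> under k" "2 * n + 1 \<notin> under k" "k \<notin> under k" "Suc k \<notin> under k"
    using le_last[of k] le_last[of "Suc k"] k p_first p_last
    by (auto simp: under_def strictly_between_def)
  have step: "Suc l \<in> under k \<longleftrightarrow> l \<in> under k" if "l \<le> 2 * n" "even (k + l)" for l
  proof (cases "l = k")
    case False
    then show ?thesis using noncrossing[OF k that(1,2)] that by (simp add: under_def)
  qed (use not_ends in auto)
  have le: "l \<le> 2 * n" if "l \<in> under k" for l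
    using that not_ends(2) by (cases "l = 2 * n + 1") (auto simp: under_def)
  have "under k = P \<union> Suc ` P"
  proof (intro equalityI subsetI)
    fix l assume l: "l \<in> under k"
    show "l \<in> P \<union> Suc ` P"
    proof (cases "even (k + l)")
      case False
      with l not_ends(1) obtain m where m: "l = Suc m" by (cases l) auto
      then have "m \<in> P" using step[of m] le[OF l] l False by (auto simp: P_def)
      then show ?thesis by (simp add: m)
    qed (use l in \<open>simp add: P_def\<close>)
  next
    fix l assume "l \<in> P \<union> Suc ` P"
    then show "l \<in> under k" using step le by (auto simp: P_def)
  qed
  moreover have "P \<inter> Suc ` P = {}" by (auto simp: P_def)
  ultimately have "sum f (under k) = sum f P + sum f (Suc ` P)"
    using finP by (simp add: sum.union_disjoint)
  also have "sum f (Suc ` P) = (\<Sum>l\<in>P. f (Suc l))"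
    by (simp add: sum.reindex)
  finally show ?thesis by (simp add: sum.distrib P_def)
qed

lemma card_below:
  assumes "x \<le> 2 * n + 2"
  shows "card {l \<in> {0..2 * n + 1}. y \<le> p l \<and> p l < x} = x - y"
proof -
  have "p ` {l \<in> {0..2 * n + 1}. y \<le> p l \<and> p l < x} = p ` {0..2 * n + 1} \<inter> {y..<x}"
    by auto
  also have "\<dots> = {0..2 * n + 1} \<inter> {y..<x}"
    using bij by (simp add: bij_betw_def)
  also have "\<dots> = {y..<x}" using assms by auto
  finally have "bij_betw p {l \<in> {0..2 * n + 1}. y \<le> p l \<and> p l < x} {y..<x}"
    using bij by (intro bij_betw_imageI) (auto simp: bij_betw_def elim!: inj_on_subset)
  then show ?thesis by (simp add: bij_betw_same_card)
qed

text \<open>An even number of points lies under an arch, so its two endpoints have different parity.\<close>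

lemma parity: "l \<le> 2 * n + 1 \<Longrightarrow> even (p l + l)"
proof (induction l)
  case (Suc k)
  define lo hi where "lo = min (p k) (p (Suc k))" and "hi = max (p k) (p (Suc k))"
  have "under k = {l \<in> {0..2 * n + 1}. Suc lo \<le> p l \<and> p l < hi}"
    by (auto simp: under_def strictly_between_def lo_def hi_def)
  moreover have "hi \<le> 2 * n + 2"
    using le_last[of k] le_last[of "Suc k"] Suc.prems by (auto simp: hi_def)
  ultimately have card: "card (under k) = hi - Suc lo"
    using card_below by simp
  have "card (under k) = (\<Sum>l | l \<in> under k \<and> even (k + l). 1 + 1)"
    using under_pairs[of k "\<lambda>_. 1::nat"] Suc.prems by simp
  then have "even (hi - Suc lo)" by (simp add: card)
  moreover have "lo < hi"
    using p_eq[of k "Suc k"] Suc.prems by (auto simp: lo_def hi_def)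
  ultimately have "odd (lo + hi)" by presburger
  then have "odd (p k + p (Suc k))" by (auto simp: lo_def hi_def min_def max_def ac_simps split: if_splits)
  then show ?case using Suc by auto
qed (simp add: p_first)

text \<open>
  The cancellations rest on this form of the entries, which separates the order of the times from the
  order of the points.
\<close>

lemma noninv_eq:
  assumes "l \<le> 2 * n + 1" "j \<le> 2 * n + 1"
  shows "noninv p l j = of_bool (p l < p j) + of_bool (l \<le> j) + 1"
proof (cases l j rule: linorder_cases)
  case greater
  then show ?thesis using p_eq[OF assms] by (cases "p l < p j") (auto simp: noninv_def)
qed (auto simp: noninv_def)

lemma noninv_commute:
  assumes "l \<le> 2 * n + 1" "j \<le> 2 * n + 1"
  shows "noninv p l j = noninv p j l"
  using p_eq[OF assms] by (auto simp: noninv_def not_less le_less)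

lemma sum_of_bool_card: "finite A \<Longrightarrow> (\<Sum>l\<in>A. of_bool (Q l) :: bit) = of_nat (card {l \<in> A. Q l})"
  by (simp add: of_bool_def sum.If_cases Int_def)

lemma degree_even:
  assumes j: "j \<le> 2 * n"
  shows "(\<Sum>l\<in>{0..2 * n}. noninv p l j) = 0"
proof -
  have "{l \<in> {0..2 * n}. p l < p j} = {l \<in> {0..2 * n + 1}. 0 \<le> p l \<and> p l < p j}"
    using p_last le_last[of j] j by (auto simp: le_Suc_eq)
  then have c: "card {l \<in> {0..2 * n}. p l < p j} = p j"
    using card_below[of "p j" 0] le_last[of j] j by simp
  have "{l \<in> {0..2 * n}. l \<le> j} = {0..j}" using j by auto
  then have c': "card {l \<in> {0..2 * n}. l \<le> j} = Suc j" by simp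
  have "(\<Sum>l\<in>{0..2 * n}. noninv p l j) =
      (\<Sum>l\<in>{0..2 * n}. of_bool (p l < p j) + of_bool (l \<le> j) + 1)"
    using j by (intro sum.cong) (simp_all add: noninv_eq del: add_bit_eq_xor)
  also have "\<dots> = of_nat (p j) + of_nat (Suc j) + of_nat (2 * n + 1)"
    by (simp only: sum.distrib sum_of_bool_card finite_atLeastAtMost c c' sum_constant)
      (simp del: add_bit_eq_xor of_nat_Suc of_nat_add)
  also have "\<dots> = of_nat (p j + Suc j + (2 * n + 1))" by (simp only: of_nat_add)
  also have "\<dots> = 0" using parity[of j] j by (simp add: of_nat_bit del: of_nat_Suc of_nat_add)
  finally show ?thesis .
qed

lemma noninv_Suc:
  assumes i: "i < 2 * n" and l: "l \<le> 2 * n"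
  shows "noninv p (Suc i) l = noninv p i l + of_bool (l \<in> under i) +
      noninv p i (Suc i) * (of_bool (l = i) + of_bool (l = Suc i))"
proof -
  have ends: "i \<notin> under i" "Suc i \<notin> under i" by (auto simp: under_def strictly_between_def)
  consider "l = i" | "l = Suc i" | "l \<noteq> i" "l \<noteq> Suc i" by blast
  then show ?thesis
  proof cases
    case 1
    then show ?thesis using noninv_commute[of i "Suc i"] i ends by (simp add: noninv_def)
  next
    case 2
    then show ?thesis using ends by (simp add: noninv_def)
  next
    case 3
    then have "Suc i < l \<longleftrightarrow> i < l" by linarith
    moreover have "l \<in> under i \<longleftrightarrow> (p (Suc i) < p l) \<noteq> (p i < p l)"
      using p_eq[of i l] p_eq[of "Suc i" l] 3 i l
      by (simp add: under_def strictly_between_def) linarith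
    ultimately show ?thesis using 3 by (cases "i < l") (auto simp: noninv_def)
  qed
qed

text \<open>
  Both sides say whether \<open>j\<close> is a time under the \<open>i\<close>-th arch and this arch runs to the left. On the
  left-hand side, the sum of \<open>of_bool (p l < p j)\<close> counts the points under the arch and before \<open>p j\<close>,
  and the remaining terms cancel except at \<open>l = j\<close>.
\<close>

lemma sum_under:
  assumes i: "i < 2 * n" and j: "j \<le> 2 * n"
  shows "(\<Sum>l\<in>under i. noninv p l j) =
    (noninv p i j + noninv p (Suc i) j) * (1 + noninv p i (Suc i))"
proof -
  define lo hi where "lo = min (p i) (p (Suc i))" and "hi = max (p i) (p (Suc i))"
  have fin: "finite (under i)" by (simp add: under_def)
  have le: "l \<le> 2 * n + 1" if "l \<in> under i" for l using that by (simp add: under_def)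
  have lohi: "lo < hi" "hi \<le> 2 * n + 1"
    using p_eq[of i "Suc i"] le_last[of i] le_last[of "Suc i"] i by (auto simp: lo_def hi_def)
  have "{l \<in> under i. p l < p j} = {l \<in> {0..2 * n + 1}. Suc lo \<le> p l \<and> p l < min hi (p j)}"
    by (auto simp: under_def strictly_between_def lo_def hi_def)
  then have c: "card {l \<in> under i. p l < p j} = min hi (p j) - Suc lo"
    using card_below[of "min hi (p j)" "Suc lo"] lohi by simp
  have "(\<Sum>l\<in>under i. of_bool (l \<le> j) + 1 :: bit) =
      (\<Sum>l | l \<in> under i \<and> even (i + l). of_bool (l \<le> j) + of_bool (Suc l \<le> j))"
    using i by (subst under_pairs) (auto intro!: sum.cong)
  also have "\<dots> = (\<Sum>l | l \<in> under i \<and> even (i + l). of_bool (l = j))"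
    by (intro sum.cong) auto
  also have "\<dots> = of_bool (j \<in> under i \<and> even (i + j))"
    using fin by (simp add: of_bool_def sum.delta)
  finally have s: "(\<Sum>l\<in>under i. of_bool (l \<le> j) + 1 :: bit) = of_bool (j \<in> under i \<and> even (i + j))" .
  have "(\<Sum>l\<in>under i. noninv p l j) =
      (\<Sum>l\<in>under i. of_bool (p l < p j) + (of_bool (l \<le> j) + 1))"
    using le j by (intro sum.cong) (auto simp: noninv_eq add.assoc)
  also have "\<dots> = of_nat (min hi (p j) - Suc lo) + of_bool (j \<in> under i \<and> even (i + j))"
    using fin by (simp only: sum.distrib[of "\<lambda>l. of_bool (p l < p j)"] sum_of_bool_card c s)
  finally have L: "(\<Sum>l\<in>under i. noninv p l j) =
      of_nat (min hi (p j) - Suc lo) + of_bool (j \<in> under i \<and> even (i + j))" .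
  have par: "even (p i + i)" "even (p (Suc i) + Suc i)" "even (p j + j)"
    using parity i j by auto
  have R: "(noninv p i j + noninv p (Suc i) j) * (1 + noninv p i (Suc i)) =
      of_bool (j \<in> under i \<and> p (Suc i) < p i)"
    unfolding noninv_Suc[OF i j] using p_eq[of i "Suc i"] i
    by (cases "noninv p i j"; cases "p i < p (Suc i)"; cases "j = i"; cases "j = Suc i")
      (auto simp: noninv_def under_def strictly_between_def)
  show ?thesis
  proof (cases "j \<in> under i")
    case True
    then have "lo < p j" "p j < hi" by (auto simp: under_def strictly_between_def lo_def hi_def)
    then have "even (min hi (p j) - Suc lo) \<longleftrightarrow> odd (p j + lo)" by auto
    then show ?thesis unfolding L R using True par
      by (auto simp: of_nat_bit lo_def min_def)
  next
    case False
    then have "p j \<le> lo \<or> hi \<le> p j"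
      using j by (auto simp: under_def strictly_between_def lo_def hi_def)
    then have "even (min hi (p j) - Suc lo)"
      using lohi par by (auto simp: lo_def hi_def min_def max_def split: if_splits)
    then have "(of_nat (min hi (p j) - Suc lo) :: bit) = 0" by (simp only: of_nat_bit not_True_eq_False simp_thms of_bool_eq)
    then show ?thesis unfolding L R using False by simp
  qed
qed

text \<open>
  Induction on the row: row \<open>0\<close> is the evenness of all degrees, and \<open>noninv_Suc\<close> describes the difference
  of two consecutive rows, whose product with the matrix is given by \<open>sum_under\<close>.
\<close>

lemma noninv_idempotent:
  assumes "i \<le> 2 * n" and j: "j \<le> 2 * n"
  shows "(\<Sum>l\<in>{0..2 * n}. noninv p i l * noninv p l j) = noninv p i j"
  using assms(1)
proof (induction i)
  case 0
  have pos: "p l \<noteq> 0" if "l \<noteq> 0" "l \<le> 2 * n" for l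
    using p_eq[of l 0] that p_first by simp
  have "(\<Sum>l\<in>{0..2 * n}. noninv p 0 l * noninv p l j) =
      (\<Sum>l\<in>{0..2 * n}. noninv p l j + of_bool (l = 0) * noninv p 0 j)"
    by (intro sum.cong) (use pos p_first in \<open>auto simp: noninv_def\<close>)
  also have "\<dots> = noninv p 0 j"
    using degree_even[OF j]
    by (simp add: sum.distrib of_bool_def if_distrib[of "\<lambda>x. x * _"] sum.delta
        del: add_bit_eq_xor mult_bit_eq_and cong: if_cong)
  finally show ?case .
next
  case (Suc i)
  then have i: "i < 2 * n" by simp
  let ?c = "noninv p i (Suc i)"
  have sub: "{0..2 * n} \<inter> under i = under i"
    using p_last le_last[of i] le_last[of "Suc i"] i by (auto simp: under_def strictly_between_def le_Suc_eq)
  have "(\<Sum>l\<in>{0..2 * n}. noninv p (Suc i) l * noninv p l j) =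
      (\<Sum>l\<in>{0..2 * n}. noninv p i l * noninv p l j + of_bool (l \<in> under i) * noninv p l j
        + ?c * (of_bool (l = i) * noninv p l j + of_bool (l = Suc i) * noninv p l j))"
    using i by (intro sum.cong) (simp_all add: noninv_Suc distrib_right distrib_left mult.assoc
        del: add_bit_eq_xor mult_bit_eq_and)
  also have "\<dots> = noninv p i j + (\<Sum>l\<in>under i. noninv p l j) + ?c * (noninv p i j + noninv p (Suc i) j)"
    using i Suc.IH sub
    by (simp add: sum.distrib of_bool_def if_distrib[of "\<lambda>x. x * _"] sum.delta
        flip: sum_distrib_left sum.inter_restrict del: add_bit_eq_xor mult_bit_eq_and cong: if_cong)
  also have "\<dots> = noninv p (Suc i) j"
    unfolding sum_under[OF i j] by (cases "noninv p i j"; cases "noninv p (Suc i) j"; cases ?c) simp_all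
  finally show ?case .
qed

end

section \<open>The two sides of a Jordan curve\<close>

text \<open>
  \<open>X\<close> and \<open>Y\<close> are the two components of the complement of the Jordan curve \<open>C\<close>, in either order: which
  of them is bounded never matters.
\<close>

definition two_sides :: "complex set \<Rightarrow> complex set \<Rightarrow> complex set \<Rightarrow> bool" where
  "two_sides C X Y \<longleftrightarrow>
     open X \<and> open Y \<and> connected X \<and> connected Y \<and> X \<inter> Y = {} \<and> X \<union> Y = - C \<and>
     C \<subseteq> closure X \<and> C \<subseteq> closure Y"

lemma two_sides_commute: "two_sides C X Y \<Longrightarrow> two_sides C Y X"
  by (auto simp: two_sides_def)

lemma two_sides_exist:
  assumes "simple_path c" "pathfinish c = pathstart c"
  shows "\<exists>X Y. two_sides (path_image c) X Y"
proof -
  note J = Jordan_inside_outside[OF assms]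
  have "path_image c \<subseteq> closure (inside (path_image c))"
    "path_image c \<subseteq> closure (outside (path_image c))"
    using J by (metis Diff_subset frontier_def)+
  then have "two_sides (path_image c) (inside (path_image c)) (outside (path_image c))"
    using J by (simp add: two_sides_def)
  then show ?thesis by blast
qed

lemma two_sides_containing:
  assumes "simple_path c" "pathfinish c = pathstart c" "w \<notin> path_image c"
  obtains X Y where "two_sides (path_image c) X Y" "w \<in> X"
proof -
  obtain X Y where XY: "two_sides (path_image c) X Y"
    using two_sides_exist[OF assms(1,2)] by blast
  then have "w \<in> X \<or> w \<in> Y" using assms(3) by (auto simp: two_sides_def)
  then show thesis using that XY two_sides_commute by blast
qed

lemma connected_subset_side:
  assumes "two_sides C X Y" "connected S" "S \<inter> C = {}" "S \<inter> X \<noteq> {}"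
  shows "S \<subseteq> X"
  using connectedD[OF assms(2), of X Y] assms(1,3,4) unfolding two_sides_def by blast

lemma side_meets_nbhd:
  assumes "two_sides C X Y" "open V" "q \<in> V" "q \<in> C"
  shows "V \<inter> X \<noteq> {}" "V \<inter> Y \<noteq> {}"
proof -
  have "q \<in> V \<inter> closure X" "q \<in> V \<inter> closure Y"
    using assms by (auto simp: two_sides_def)
  then show "V \<inter> X \<noteq> {}" "V \<inter> Y \<noteq> {}"
    using open_Int_closure_eq_empty[OF assms(2)] by blast+
qed

text \<open>If a neighbourhood is cut by \<open>C\<close> into two connected halves, they lie on different sides of \<open>C\<close>.\<close>

lemma halves_on_opposite_sides:
  assumes C: "two_sides C X Y" and V: "open V" "q \<in> V" "q \<in> C"
    and H: "V - C = H1 \<union> H2" "connected H1" "connected H2"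
  shows "H1 \<subseteq> X \<and> H2 \<subseteq> Y \<or> H1 \<subseteq> Y \<and> H2 \<subseteq> X"
proof -
  note side1 = connected_subset_side[OF C] and side2 = connected_subset_side[OF two_sides_commute[OF C]]
  obtain x y where xy: "x \<in> V" "x \<in> X" "y \<in> V" "y \<in> Y"
    using side_meets_nbhd[OF C V] by blast
  then have "x \<in> H1 \<union> H2" "y \<in> H1 \<union> H2" "x \<notin> Y" "y \<notin> X"
    using C H(1) by (auto simp: two_sides_def)
  moreover have "H1 \<inter> C = {}" "H2 \<inter> C = {}" using H(1) by blast+
  ultimately show ?thesis
    using side1[OF H(2)] side1[OF H(3)] side2[OF H(2)] side2[OF H(3)] xy by blast
qed

text \<open>
  The Jordan curve \<open>E\<close> stays in \<open>C \<union> X\<close> and follows \<open>C\<close> near \<open>q\<close>. The side \<open>Y\<close> of \<open>C\<close> then lies on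
  one side \<open>P\<close> of \<open>E\<close>. If a connected set \<open>F\<close> in \<open>X\<close> avoids \<open>E\<close>, lies in \<open>P\<close> and reaches the
  neighbourhood \<open>V\<close> of \<open>q\<close>, then both halves of \<open>V\<close> lie in \<open>P\<close>, although \<open>q\<close> is in the closure
  of the other side of \<open>E\<close>.
\<close>

lemma arch_not_crossed:
  assumes C: "two_sides C X Y" and E: "two_sides E P Q"
    and EY: "E \<inter> Y = {}" and YP: "Y \<inter> P \<noteq> {}"
    and q: "q \<in> E" "q \<in> V" and V: "open V" "V \<inter> C = V \<inter> E"
    and H: "V - C = H1 \<union> H2" "connected H1" "connected H2"
    and F: "connected F" "F \<subseteq> X" "F \<inter> E = {}" "F \<inter> V \<noteq> {}" "F \<inter> P \<noteq> {}"
  shows False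
proof -
  have "connected Y" using C by (simp add: two_sides_def)
  then have Y: "Y \<subseteq> P" using connected_subset_side[OF E] EY YP by blast
  have FP: "F \<subseteq> P" using connected_subset_side[OF E] F by blast
  have *: False if "H \<subseteq> X" "H' \<subseteq> Y" "V - C = H \<union> H'" "connected H" for H H'
  proof -
    have "X \<inter> Y = {}" "X \<inter> C = {}" using C by (auto simp: two_sides_def)
    then have "F \<inter> V \<subseteq> H" using that(2,3) F(2) by blast
    then have "H \<inter> P \<noteq> {}" using F(4) FP by blast
    moreover have "H \<inter> E = {}" using that(3) V(2) by blast
    ultimately have "H \<subseteq> P" using connected_subset_side[OF E that(4)] by blast
    then have "V - E \<subseteq> P" using that Y V(2) by blast
    moreover have "V \<inter> Q \<noteq> {}" using side_meets_nbhd[OF E V(1) q(2,1)] by blast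
    ultimately show False using E by (auto simp: two_sides_def)
  qed
  have "q \<in> C" using q V by blast
  from halves_on_opposite_sides[OF C V(1) q(2) this H] show False
    using *[of H1 H2] *[of H2 H1] H by blast
qed

section \<open>Transversal crossings of arcs\<close>

text \<open>
  The inverse of the chart at a transversal crossing, restricted to a disc so small that its image lies
  in a given neighbourhood.
\<close>

lemma crossing_chart:
  assumes "crosses_transversally_at S T q" "open W" "q \<in> W"
  obtains r k where "0 < r" "k 0 = q" "continuous_on (ball 0 r) k" "inj_on k (ball 0 r)"
    "open (k ` ball 0 r)" "k ` ball 0 r \<subseteq> W"
    "\<And>w. w \<in> ball 0 r \<Longrightarrow> k w \<in> S \<longleftrightarrow> Im w = 0"
    "\<And>w. w \<in> ball 0 r \<Longrightarrow> k w \<in> T \<longleftrightarrow> Re w = 0"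
proof -
  obtain U h k where U: "open U" "q \<in> U" "homeomorphism U (ball 0 1) h k" "h q = 0"
    and S: "h ` (U \<inter> S) = {z \<in> ball 0 1. Im z = 0}"
    and T: "h ` (U \<inter> T) = {z \<in> ball 0 1. Re z = 0}"
    using assms(1) by (auto simp: crosses_transversally_at_def)
  note hom = U(3)[unfolded homeomorphism_def]
  have hk: "h (k w) = w" "k w \<in> U" if "w \<in> ball 0 1" for w using hom that by auto
  have kh: "k (h x) = x" "h x \<in> ball 0 1" if "x \<in> U" for x using hom that by auto
  have k0: "k 0 = q" using kh(1)[OF U(2)] U(4) by simp
  have contk: "continuous_on (ball 0 1) k" using hom by simp
  have "open (ball 0 1 \<inter> k -` W)"
    using contk assms(2) by (intro continuous_open_preimage) auto
  moreover have "0 \<in> ball 0 1 \<inter> k -` W" using k0 assms(3) by simp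
  ultimately obtain r where r: "0 < r" "ball 0 r \<subseteq> ball 0 1 \<inter> k -` W"
    by (meson open_contains_ball)
  have sub: "w \<in> ball 0 1" if "w \<in> ball 0 r" for w :: complex using r that by blast
  have img: "k ` ball 0 r = U \<inter> h -` ball 0 r"
  proof (intro equalityI subsetI)
    fix x assume "x \<in> U \<inter> h -` ball 0 r"
    then show "x \<in> k ` ball 0 r" using kh[of x] by (intro image_eqI[of _ _ "h x"]) auto
  qed (use hk sub in auto)
  have mem: "k w \<in> A \<longleftrightarrow> w \<in> h ` (U \<inter> A)" if "w \<in> ball 0 r" for w A
  proof
    assume "k w \<in> A"
    then show "w \<in> h ` (U \<inter> A)"
      using hk[OF sub[OF that]] by (intro image_eqI[of _ _ "k w"]) auto
  next
    assume "w \<in> h ` (U \<inter> A)"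
    then show "k w \<in> A" using kh by auto
  qed
  show thesis
  proof (rule that[of r k])
    show "continuous_on (ball 0 r) k" using contk r(2) by (auto intro: continuous_on_subset)
    show "inj_on k (ball 0 r)" using hk sub by (metis inj_onI)
    show "open (k ` ball 0 r)" unfolding img using hom U(1) by (intro continuous_open_preimage) auto
    show "k ` ball 0 r \<subseteq> W" using r(2) by auto
  qed (use r(1) k0 sub in \<open>simp_all add: mem S T del: mem_ball\<close>)
qed

text \<open>The image under \<open>k\<close> of the open radius of length \<open>r\<close> in the direction of the unit vector \<open>d\<close>.\<close>

definition chart_ray :: "(complex \<Rightarrow> complex) \<Rightarrow> real \<Rightarrow> complex \<Rightarrow> complex set" where
  "chart_ray k r d = (\<lambda>y. k (of_real y * d)) ` {0<..<r}"

lemma arc_near: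
  fixes \<gamma> :: "real \<Rightarrow> complex"
  assumes "arc \<gamma>" "0 < t" "t < 1" "open V" "\<gamma> t \<in> V"
  obtains d where "d > 0" "d \<le> t" "d \<le> 1 - t" "\<And>s. s \<in> {t - d<..<t + d} \<Longrightarrow> \<gamma> s \<in> V"
proof -
  have "continuous_on {0..1} \<gamma>" using assms(1) by (simp add: arc_def path_def)
  then have "isCont \<gamma> t" using assms(2,3) by (intro continuous_on_interior[of "{0..1}"]) auto
  obtain r where r: "r > 0" "ball (\<gamma> t) r \<subseteq> V" using assms(4,5) open_contains_ball by blast
  then obtain e where e: "e > 0" "\<And>s. dist s t < e \<Longrightarrow> dist (\<gamma> s) (\<gamma> t) < r"
    using \<open>isCont \<gamma> t\<close> unfolding continuous_at_eps_delta by blast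
  have V: "\<gamma> s \<in> V" if "\<bar>s - t\<bar> < e" for s
    using e(2)[of s] r(2) that by (auto simp: dist_real_def dist_commute)
  show thesis
    by (rule that[of "min e (min t (1 - t))"]) (use e(1) assms(2,3) in \<open>auto intro!: V\<close>)
qed

lemma arc_inj: "arc \<gamma> \<Longrightarrow> s \<in> {0..1} \<Longrightarrow> t \<in> {0..1} \<Longrightarrow> \<gamma> s = \<gamma> t \<longleftrightarrow> s = t"
  by (auto simp: arc_def inj_on_def)

text \<open>
  If an arc appears in a chart as a diameter, then the parts of the arc before and after the centre appear
  as the two opposite radii.
\<close>

lemma arc_splits_rays:
  assumes g: "arc \<gamma>" "0 < t" "t < 1"
    and k: "0 < r" "k 0 = \<gamma> t" "continuous_on (ball 0 r) k" "inj_on k (ball 0 r)" "open (k ` ball 0 r)"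
    and d0: "norm d0 = 1"
    and diam: "\<And>w. w \<in> ball 0 r \<Longrightarrow> k w \<in> path_image \<gamma> \<longleftrightarrow> (\<exists>y. w = of_real y * d0)"
  obtains d where "d \<in> {d0, - d0}"
    "chart_ray k r d \<subseteq> \<gamma> ` {0..<t}" "chart_ray k r (- d) \<subseteq> \<gamma> ` {t<..1}"
    "\<And>s. s \<in> {0..<t} \<Longrightarrow> \<gamma> s \<in> k ` ball 0 r \<Longrightarrow> \<gamma> s \<in> chart_ray k r d"
    "\<And>s. s \<in> {t<..1} \<Longrightarrow> \<gamma> s \<in> k ` ball 0 r \<Longrightarrow> \<gamma> s \<in> chart_ray k r (- d)"
proof -
  have cont: "continuous_on {0..1} \<gamma>" using g(1) by (simp add: arc_def path_def)
  define L R L' R' where "L = \<gamma> ` {0..<t}" and "R = \<gamma> ` {t<..1}"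
    and "L' = \<gamma> ` {0..t}" and "R' = \<gamma> ` {t..1}"
  have halves: "path_image \<gamma> - {\<gamma> t} = L \<union> R"
    using g arc_inj[OF g(1)] by (force simp: path_image_def L_def R_def)
  have disj: "L' \<inter> R' \<subseteq> {\<gamma> t}" "L \<inter> R = {}"
    using g arc_inj[OF g(1)] by (force simp: L_def R_def L'_def R'_def)+
  have sub: "L \<subseteq> L'" "R \<subseteq> R'" by (auto simp: L_def R_def L'_def R'_def)
  have closed: "closed L'" "closed R'" unfolding L'_def R'_def
    using g by (auto intro!: compact_imp_closed compact_continuous_image continuous_on_subset[OF cont])
  have ray_sub: "chart_ray k r d \<subseteq> path_image \<gamma> - {\<gamma> t}" "connected (chart_ray k r d)"
    if d: "d \<in> {d0, - d0}" for d
  proof -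
    have nd: "norm d = 1" "d \<noteq> 0" using d d0 by auto
    have b: "of_real y * d \<in> ball 0 r" if "y \<in> {0<..<r}" for y
      using that nd by (simp add: norm_mult)
    show "chart_ray k r d \<subseteq> path_image \<gamma> - {\<gamma> t}"
    proof
      fix x assume "x \<in> chart_ray k r d"
      then obtain y where y: "y \<in> {0<..<r}" "x = k (of_real y * d)" by (auto simp: chart_ray_def)
      have "\<exists>y'. of_real y * d = of_real y' * d0"
        using d by (auto intro: exI[of _ "y"] exI[of _ "- y"])
      then have "x \<in> path_image \<gamma>" using diam[OF b[OF y(1)]] y(2) by simp
      moreover have "x \<noteq> k 0"
        using inj_onD[OF k(4), of "of_real y * d" 0] b[OF y(1)] y k(1) nd by auto
      ultimately show "x \<in> path_image \<gamma> - {\<gamma> t}" using k(2) by simp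
    qed
    have "continuous_on {0<..<r} (k \<circ> (\<lambda>y. of_real y * d))"
      by (intro continuous_on_compose continuous_intros continuous_on_subset[OF k(3)]) (use b in auto)
    then have "continuous_on {0<..<r} (\<lambda>y. k (of_real y * d))" by (simp add: o_def)
    then show "connected (chart_ray k r d)"
      unfolding chart_ray_def by (intro connected_continuous_image) auto
  qed
  \<comment> \<open>A radius is connected and avoids the centre, so it cannot meet both closed halves of the arc.\<close>
  have one: "chart_ray k r d \<subseteq> L \<or> chart_ray k r d \<subseteq> R" if d: "d \<in> {d0, - d0}" for d
  proof -
    have "L' \<inter> R' \<inter> chart_ray k r d = {}" "chart_ray k r d \<subseteq> L' \<union> R'"
      using ray_sub(1)[OF d] disj(1) halves sub by blast+
    then have "L' \<inter> chart_ray k r d = {} \<or> R' \<inter> chart_ray k r d = {}"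
      using connected_closedD[OF ray_sub(2)[OF d] _ _ closed] by blast
    then show ?thesis using ray_sub(1)[OF d] halves sub by blast
  qed
  have cover: "\<gamma> s \<in> chart_ray k r d0 \<union> chart_ray k r (- d0)"
    if s: "s \<in> {0..1}" "s \<noteq> t" "\<gamma> s \<in> k ` ball 0 r" for s
  proof -
    obtain w where w: "w \<in> ball 0 r" "\<gamma> s = k w" using s(3) by blast
    then obtain y where y: "w = of_real y * d0"
      using diam[OF w(1)] s(1) by (metis image_eqI path_image_def)
    have "y \<noteq> 0" using y w k(2) s g arc_inj[OF g(1), of s t] by auto
    moreover have "\<bar>y\<bar> < r" using w(1) y d0 by (simp add: norm_mult)
    ultimately show ?thesis using w y
      by (cases "0 < y") (auto simp: chart_ray_def intro!: image_eqI[of _ _ "y"] image_eqI[of _ _ "- y"])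
  qed
  have "\<gamma> t \<in> k ` ball 0 r" using k(1,2) by (metis centre_in_ball image_eqI)
  then obtain e where e: "e > 0" "e \<le> t" "e \<le> 1 - t"
    "\<And>s. s \<in> {t - e<..<t + e} \<Longrightarrow> \<gamma> s \<in> k ` ball 0 r"
    using arc_near[OF g k(5)] by blast
  define s1 s2 where "s1 = t - e / 2" and "s2 = t + e / 2"
  have s12: "s1 \<in> {0..<t}" "s2 \<in> {t<..1}" "\<gamma> s1 \<in> k ` ball 0 r" "\<gamma> s2 \<in> k ` ball 0 r"
    using e by (auto simp: s1_def s2_def)
  then have c: "\<gamma> s1 \<in> chart_ray k r d0 \<union> chart_ray k r (- d0)"
    "\<gamma> s2 \<in> chart_ray k r d0 \<union> chart_ray k r (- d0)"
    using cover[of s1] cover[of s2] g by auto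
  \<comment> \<open>The arc comes close to the centre on both sides, so the radii belong to different halves.\<close>
  have m: "\<gamma> s1 \<in> L" "\<gamma> s2 \<in> R" using s12 by (auto simp: L_def R_def)
  have "chart_ray k r d0 \<subseteq> L \<and> chart_ray k r (- d0) \<subseteq> R \<or>
    chart_ray k r (- d0) \<subseteq> L \<and> chart_ray k r d0 \<subseteq> R"
    using one[of d0] one[of "- d0"] c m disj(2) by blast
  then obtain d where d: "d \<in> {d0, - d0}" "chart_ray k r d \<subseteq> L" "chart_ray k r (- d) \<subseteq> R"
    by (metis insertCI minus_minus)
  have cover': "\<gamma> s \<in> chart_ray k r d \<union> chart_ray k r (- d)"
    if "s \<in> {0..1}" "s \<noteq> t" "\<gamma> s \<in> k ` ball 0 r" for s
    using cover[OF that] d(1) by auto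
  show thesis
  proof (rule that[OF d(1) d(2,3)[unfolded L_def R_def]])
    fix s assume s: "s \<in> {0..<t}" "\<gamma> s \<in> k ` ball 0 r"
    then have "\<gamma> s \<in> L" "s \<in> {0..1}" "s \<noteq> t" using g by (auto simp: L_def)
    then show "\<gamma> s \<in> chart_ray k r d" using cover'[of s] s d(3) disj(2) by blast
  next
    fix s assume s: "s \<in> {t<..1}" "\<gamma> s \<in> k ` ball 0 r"
    then have "\<gamma> s \<in> R" "s \<in> {0..1}" "s \<noteq> t" using g by (auto simp: R_def)
    then show "\<gamma> s \<in> chart_ray k r (- d)" using cover'[of s] s d(2) disj(2) by blast
  qed
qed

text \<open>At a transversal crossing the arc passes from one half of a neighbourhood to the other.\<close>

lemma crossing_neighbourhood:
  assumes cr: "crosses_transversally_at S (path_image \<gamma>) (\<gamma> t)"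
    and g: "arc \<gamma>" "0 < t" "t < 1" and W: "open W" "\<gamma> t \<in> W"
  obtains V H1 H2 d where "open V" "\<gamma> t \<in> V" "V \<subseteq> W"
    "connected H1" "connected H2" "V - S = H1 \<union> H2" "d > 0"
    "\<And>s. s \<in> {t - d<..<t} \<Longrightarrow> \<gamma> s \<in> H1" "\<And>s. s \<in> {t<..<t + d} \<Longrightarrow> \<gamma> s \<in> H2"
proof -
  obtain r k where k: "0 < r" "k 0 = \<gamma> t" "continuous_on (ball 0 r) k" "inj_on k (ball 0 r)"
    "open (k ` ball 0 r)" "k ` ball 0 r \<subseteq> W"
    and S: "\<And>w. w \<in> ball 0 r \<Longrightarrow> k w \<in> S \<longleftrightarrow> Im w = 0"
    and T: "\<And>w. w \<in> ball 0 r \<Longrightarrow> k w \<in> path_image \<gamma> \<longleftrightarrow> Re w = 0"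
    using crossing_chart[OF cr W] by blast
  have "k w \<in> path_image \<gamma> \<longleftrightarrow> (\<exists>y. w = of_real y * \<i>)" if "w \<in> ball 0 r" for w
    using T[OF that] by (auto simp: complex_eq_iff)
  from arc_splits_rays[OF g k(1-5) _ this]
  obtain d where d: "d \<in> {\<i>, - \<i>}"
    and ray: "\<And>s. s \<in> {0..<t} \<Longrightarrow> \<gamma> s \<in> k ` ball 0 r \<Longrightarrow> \<gamma> s \<in> chart_ray k r d"
      "\<And>s. s \<in> {t<..1} \<Longrightarrow> \<gamma> s \<in> k ` ball 0 r \<Longrightarrow> \<gamma> s \<in> chart_ray k r (- d)"
    by (metis norm_ii)
  define H where "H e = k ` (ball 0 r \<inter> {w. 0 < Im e * Im w})" for e
  have conn: "connected (H e)" for e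
  proof -
    have "convex {w. 0 < Im e * Im w}"
    proof -
      have "{w. 0 < Im e * Im w} = {w. 0 < inner (Complex 0 (Im e)) w}" by (simp add: inner_complex_def)
      then show ?thesis using convex_halfspace_gt[of 0] by simp
    qed
    then show ?thesis unfolding H_def
      by (intro connected_continuous_image continuous_on_subset[OF k(3)] convex_connected convex_Int) auto
  qed
  have rayH: "chart_ray k r e \<subseteq> H e" if "e \<in> {\<i>, - \<i>}" for e
  proof
    fix x assume "x \<in> chart_ray k r e"
    then obtain y where y: "0 < y" "y < r" "x = k (of_real y * e)" by (auto simp: chart_ray_def)
    then have "of_real y * e \<in> ball 0 r \<inter> {w. 0 < Im e * Im w}"
      using that by (auto simp: norm_mult)
    then show "x \<in> H e" using y(3) by (simp only: H_def image_eqI)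
  qed
  have "k ` ball 0 r - S = k ` (ball 0 r \<inter> {w. Im w \<noteq> 0})" using S by auto
  also have "{w. Im w \<noteq> 0} = {w. 0 < Im d * Im w} \<union> {w. 0 < Im (- d) * Im w}" using d by auto
  finally have "k ` ball 0 r - S = H d \<union> H (- d)" by (simp only: H_def Int_Un_distrib image_Un)
  moreover obtain e where e: "e > 0" "e \<le> t" "e \<le> 1 - t"
    "\<And>s. s \<in> {t - e<..<t + e} \<Longrightarrow> \<gamma> s \<in> k ` ball 0 r"
    using arc_near[OF g k(5)] k(1,2) by (metis centre_in_ball image_eqI)
  ultimately show thesis
  proof (intro that[of "k ` ball 0 r" "H d" "H (- d)" e])
    show "\<gamma> t \<in> k ` ball 0 r" using k(1,2) by (metis centre_in_ball image_eqI)
    fix s assume "s \<in> {t - e<..<t}"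
    then show "\<gamma> s \<in> H d" using e ray(1)[of s] rayH[of d] d by auto
  next
    fix s assume "s \<in> {t<..<t + e}"
    then show "\<gamma> s \<in> H (- d)" using e ray(2)[of s] rayH[of "- d"] d by auto
  qed (use k conn in auto)
qed

text \<open>
  At a transversal crossing of two arcs the incoming parts of both arcs can be joined inside one of the
  four quadrants, without meeting the outgoing parts.
\<close>

lemma crossing_corner:
  assumes cr: "crosses_transversally_at (path_image \<beta>) (path_image \<alpha>) z"
    and b: "arc \<beta>" "0 < tb" "tb < 1" "\<beta> tb = z" and a: "arc \<alpha>" "0 < ta" "ta < 1" "\<alpha> ta = z"
    and W: "open W" "z \<in> W"
  obtains K where "connected K" "K \<subseteq> W" "K \<inter> \<beta> ` {tb..1} = {}" "K \<inter> \<alpha> ` {ta..1} = {}"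
    "K \<inter> \<beta> ` {0..<tb} \<noteq> {}" "K \<inter> \<alpha> ` {0..<ta} \<noteq> {}"
proof -
  obtain r k where k: "0 < r" "k 0 = z" "continuous_on (ball 0 r) k" "inj_on k (ball 0 r)"
    "open (k ` ball 0 r)" "k ` ball 0 r \<subseteq> W"
    and S: "\<And>w. w \<in> ball 0 r \<Longrightarrow> k w \<in> path_image \<beta> \<longleftrightarrow> Im w = 0"
    and T: "\<And>w. w \<in> ball 0 r \<Longrightarrow> k w \<in> path_image \<alpha> \<longleftrightarrow> Re w = 0"
    using crossing_chart[OF cr W] by blast
  have "k w \<in> path_image \<alpha> \<longleftrightarrow> (\<exists>y. w = of_real y * \<i>)" if "w \<in> ball 0 r" for w
    using T[OF that] by (auto simp: complex_eq_iff)
  from arc_splits_rays[OF a(1-3) k(1) _ k(3-5) _ this]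
  obtain d where d: "d \<in> {\<i>, - \<i>}" and dray: "chart_ray k r d \<subseteq> \<alpha> ` {0..<ta}"
    using k(2) a(4) by (metis norm_ii)
  have "k w \<in> path_image \<beta> \<longleftrightarrow> (\<exists>y. w = of_real y * 1)" if "w \<in> ball 0 r" for w
    using S[OF that] by (auto simp: complex_eq_iff)
  from arc_splits_rays[OF b(1-3) k(1) _ k(3-5) _ this]
  obtain e where e: "e \<in> {1, - 1}" and eray: "chart_ray k r e \<subseteq> \<beta> ` {0..<tb}"
    using k(2) b(4) by (metis norm_one)
  \<comment> \<open>The straight segment between a point on each incoming radius meets the axes only at its ends.\<close>
  define v where "v = of_real (r / 2) * e"
  define w where "w = of_real (r / 2) * d"
  define K where "K = k ` closed_segment v w"
  have half: "r / 2 \<in> {0<..<r}" using k(1) by simp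
  have "k v \<in> chart_ray k r e" "k w \<in> chart_ray k r d"
    using imageI[OF half, of "\<lambda>y. k (of_real y * e)"] imageI[OF half, of "\<lambda>y. k (of_real y * d)"]
    by (simp_all only: chart_ray_def v_def w_def)
  moreover have "v \<in> ball 0 r" "w \<in> ball 0 r"
    using k(1) d e by (auto simp: v_def w_def norm_mult)
  ultimately have vw: "v \<in> ball 0 r" "w \<in> ball 0 r"
    "k v \<in> chart_ray k r e" "k w \<in> chart_ray k r d" by blast+
  have seg: "closed_segment v w \<subseteq> ball 0 r"
    using vw by (simp add: closed_segment_subset)
  have xs: "x = v" if "x \<in> closed_segment v w" "Im x = 0" for x
    using that e d k(1) by (auto simp: closed_segment_def v_def w_def complex_eq_iff)
  have xt: "x = w" if "x \<in> closed_segment v w" "Re x = 0" for x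
    using that e d k(1) by (auto simp: closed_segment_def v_def w_def complex_eq_iff)
  have "\<beta> ` {tb..1} \<inter> \<beta> ` {0..<tb} = {}" "\<alpha> ` {ta..1} \<inter> \<alpha> ` {0..<ta} = {}"
    using arc_inj[OF b(1)] arc_inj[OF a(1)] a(2,3) b(2,3) by force+
  then have nv: "k v \<notin> \<beta> ` {tb..1}" "k w \<notin> \<alpha> ` {ta..1}"
    using vw eray dray by (metis disjoint_iff subsetD)+
  show thesis
  proof (rule that[of K])
    show "connected K" unfolding K_def
      by (intro connected_continuous_image continuous_on_subset[OF k(3)] seg) simp
    show "K \<subseteq> W" using seg k(6) by (auto simp: K_def)
    show "K \<inter> \<beta> ` {tb..1} = {}"
    proof (rule ccontr)
      assume "K \<inter> \<beta> ` {tb..1} \<noteq> {}"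
      then obtain x where x: "x \<in> closed_segment v w" "k x \<in> \<beta> ` {tb..1}" by (auto simp: K_def)
      moreover from this have "k x \<in> path_image \<beta>" using b by (auto simp: path_image_def)
      ultimately show False using S[of x] seg xs[of x] nv by auto
    qed
    show "K \<inter> \<alpha> ` {ta..1} = {}"
    proof (rule ccontr)
      assume "K \<inter> \<alpha> ` {ta..1} \<noteq> {}"
      then obtain x where x: "x \<in> closed_segment v w" "k x \<in> \<alpha> ` {ta..1}" by (auto simp: K_def)
      moreover from this have "k x \<in> path_image \<alpha>" using a by (auto simp: path_image_def)
      ultimately show False using T[of x] seg xt[of x] nv by auto
    qed
    show "K \<inter> \<beta> ` {0..<tb} \<noteq> {}" "K \<inter> \<alpha> ` {0..<ta} \<noteq> {}"
      using vw eray dray by (auto simp: K_def)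
  qed
qed

section \<open>Two simple loops touching at a point\<close>

lemma simple_loop_inj:
  assumes "simple_path c" "s \<in> {0..1}" "t \<in> {0<..<1}" "c s = c t"
  shows "s = t"
  using assms by (fastforce simp: simple_path_def loop_free_def)

text \<open>
  Two simple loops \<open>c\<close> and \<open>g\<close> with a common base point. They meet at the parameters \<open>\<sigma> 0 = 0, \<dots>,
  \<sigma> (2 * n + 1) = 1\<close> of \<open>c\<close> and \<open>\<tau> 0 = 0, \<dots>, \<tau> (2 * n + 1) = 1\<close> of \<open>g\<close>, matched by \<open>p\<close>; the
  base point bears both labels \<open>0\<close> and \<open>2 * n + 1\<close>. At the other meeting points, \<open>g\<close> crosses \<open>c\<close>
  (assumption \<open>cross\<close>). At the base point they touch, in such a way that the two final parts can be joined
  without meeting the rest of the loops (assumption \<open>corner\<close>).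
\<close>

locale touching_loops =
  fixes n :: nat and p :: "nat \<Rightarrow> nat" and c g :: "real \<Rightarrow> complex" and \<sigma> \<tau> :: "nat \<Rightarrow> real"
  assumes simple: "simple_path c" "simple_path g"
    and closing: "c 1 = c 0" "g 1 = g 0"
    and p_range: "\<And>k. k \<in> {1..2 * n} \<Longrightarrow> p k \<in> {1..2 * n}"
    and p_ends: "p 0 = 0" "p (2 * n + 1) = 2 * n + 1"
    and \<sigma>_mono: "strict_mono_on {0..2 * n + 1} \<sigma>" and \<sigma>_ends: "\<sigma> 0 = 0" "\<sigma> (2 * n + 1) = 1"
    and \<tau>_mono: "strict_mono_on {0..2 * n + 1} \<tau>" and \<tau>_ends: "\<tau> 0 = 0" "\<tau> (2 * n + 1) = 1"
    and meet: "\<And>k. k \<le> 2 * n + 1 \<Longrightarrow> g (\<tau> k) = c (\<sigma> (p k))"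
    and meet_only: "\<And>s. s \<in> {0..1} \<Longrightarrow> g s \<in> path_image c \<Longrightarrow> \<exists>k\<le>2 * n + 1. s = \<tau> k"
    and cross: "\<And>k W. k \<in> {1..2 * n} \<Longrightarrow> open W \<Longrightarrow> g (\<tau> k) \<in> W \<Longrightarrow>
      \<exists>V H1 H2 d. open V \<and> g (\<tau> k) \<in> V \<and> V \<subseteq> W \<and> connected H1 \<and> connected H2 \<and>
        V - path_image c = H1 \<union> H2 \<and> 0 < d \<and>
        (\<forall>s\<in>{\<tau> k - d<..<\<tau> k}. g s \<in> H1) \<and> (\<forall>s\<in>{\<tau> k<..<\<tau> k + d}. g s \<in> H2)"
    and corner: "\<And>s. s \<in> {0..<1} \<Longrightarrow>
      \<exists>K. connected K \<and> K \<inter> c ` {0..s} = {} \<and> K \<inter> g ` {0..s} = {} \<and>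
        K \<inter> path_image c \<noteq> {} \<and> K \<inter> path_image g \<noteq> {}"
begin

abbreviation C where "C \<equiv> path_image c"

lemma \<sigma>_less: "i \<le> 2 * n + 1 \<Longrightarrow> j \<le> 2 * n + 1 \<Longrightarrow> \<sigma> i < \<sigma> j \<longleftrightarrow> i < j"
  using strict_mono_on_less[OF \<sigma>_mono] by simp

lemma \<tau>_less: "i \<le> 2 * n + 1 \<Longrightarrow> j \<le> 2 * n + 1 \<Longrightarrow> \<tau> i < \<tau> j \<longleftrightarrow> i < j"
  using strict_mono_on_less[OF \<tau>_mono] by simp

lemma \<sigma>_le: "i \<le> 2 * n + 1 \<Longrightarrow> j \<le> 2 * n + 1 \<Longrightarrow> \<sigma> i \<le> \<sigma> j \<longleftrightarrow> i \<le> j"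
  using \<sigma>_less[of j i] by linarith

lemma \<tau>_le: "i \<le> 2 * n + 1 \<Longrightarrow> j \<le> 2 * n + 1 \<Longrightarrow> \<tau> i \<le> \<tau> j \<longleftrightarrow> i \<le> j"
  using \<tau>_less[of j i] by linarith

lemma \<sigma>_range: "i \<le> 2 * n + 1 \<Longrightarrow> \<sigma> i \<in> {0..1}"
  using \<sigma>_le[of 0 i] \<sigma>_le[of i "2 * n + 1"] \<sigma>_ends by simp

lemma \<tau>_range: "i \<le> 2 * n + 1 \<Longrightarrow> \<tau> i \<in> {0..1}"
  using \<tau>_le[of 0 i] \<tau>_le[of i "2 * n + 1"] \<tau>_ends by simp

lemma \<sigma>_inner: "i \<in> {1..2 * n} \<Longrightarrow> \<sigma> i \<in> {0<..<1}"
  using \<sigma>_less[of 0 i] \<sigma>_less[of i "2 * n + 1"] \<sigma>_ends by simp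

lemma \<tau>_inner: "i \<in> {1..2 * n} \<Longrightarrow> \<tau> i \<in> {0<..<1}"
  using \<tau>_less[of 0 i] \<tau>_less[of i "2 * n + 1"] \<tau>_ends by simp

lemma p_le: "k \<le> 2 * n + 1 \<Longrightarrow> p k \<le> 2 * n + 1"
  using p_range[of k] p_ends by (cases "k = 0"; cases "k = 2 * n + 1") auto

lemma p_inner: "k \<le> 2 * n + 1 \<Longrightarrow> p k \<in> {1..2 * n} \<longleftrightarrow> k \<in> {1..2 * n}"
  using p_range[of k] p_ends by (cases "k = 0"; cases "k = 2 * n + 1") auto

lemma p_inj: "inj_on p {0..2 * n + 1}"
proof (rule inj_onI)
  fix k l assume kl: "k \<in> {0..2 * n + 1}" "l \<in> {0..2 * n + 1}" and eq: "p k = p l"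
  show "k = l"
  proof (cases "k \<in> {1..2 * n}")
    case True
    have "g (\<tau> l) = g (\<tau> k)" using meet[of k] meet[of l] kl eq by simp
    then have "\<tau> l = \<tau> k"
      using simple_loop_inj[OF simple(2), of "\<tau> l" "\<tau> k"] \<tau>_range[of l] \<tau>_inner[OF True] kl by auto
    then show ?thesis using \<tau>_less[of k l] \<tau>_less[of l k] kl by (metis atLeastAtMost_iff less_irrefl linorder_neqE_nat)
  next
    case False
    then have "l \<notin> {1..2 * n}" using p_inner[of k] p_inner[of l] kl eq by auto
    then have "k = 0 \<or> k = 2 * n + 1" "l = 0 \<or> l = 2 * n + 1" using False kl by auto
    then show ?thesis using p_ends eq by auto
  qed
qed

lemma p_bij: "bij_betw p {0..2 * n + 1} {0..2 * n + 1}"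
proof -
  have sub: "p ` {0..2 * n + 1} \<subseteq> {0..2 * n + 1}"
    using p_le by (intro image_subsetI) (simp del: One_nat_def)
  show ?thesis using endo_inj_surj[OF _ sub p_inj] p_inj by (simp add: bij_betw_def)
qed

lemma p_eq_iff: "k \<le> 2 * n + 1 \<Longrightarrow> l \<le> 2 * n + 1 \<Longrightarrow> p k = p l \<longleftrightarrow> k = l"
  using p_inj by (auto simp: inj_on_def)

text \<open>The open piece of \<open>g\<close> between two consecutive meeting points with \<open>c\<close>.\<close>

definition arch :: "nat \<Rightarrow> complex set" where
  "arch k = g ` {\<tau> k<..<\<tau> (Suc k)}"

lemma path_g: "continuous_on {0..1} g" "continuous_on {0..1} c"
  using simple by (auto simp: simple_path_def path_def)

lemma arch_connected: "k \<le> 2 * n \<Longrightarrow> connected (arch k)"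
  unfolding arch_def using \<tau>_range[of k] \<tau>_range[of "Suc k"]
  by (intro connected_continuous_image continuous_on_subset[OF path_g(1)]) auto

lemma arch_off_C:
  assumes "k \<le> 2 * n" shows "arch k \<inter> C = {}"
proof -
  have "g s \<notin> C" if s: "s \<in> {\<tau> k<..<\<tau> (Suc k)}" for s
  proof
    assume gs: "g s \<in> C"
    have "s \<in> {0..1}" using s(1) \<tau>_range[of k] \<tau>_range[of "Suc k"] assms by auto
    then obtain m where "m \<le> 2 * n + 1" "s = \<tau> m" using meet_only gs by blast
    then show False using s \<tau>_less[of k m] \<tau>_less[of m "Suc k"] assms by auto
  qed
  then show ?thesis by (auto simp: arch_def)
qed

lemma arch_nonempty: "k \<le> 2 * n \<Longrightarrow> arch k \<noteq> {}"
  using \<tau>_less[of k "Suc k"] by (simp add: arch_def)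

lemma arch_sides_alternate:
  assumes XY: "two_sides C X Y" and k: "k < 2 * n" and X: "arch k \<subseteq> X"
  shows "arch (Suc k) \<subseteq> Y"
proof -
  obtain V H1 H2 d where V: "open V" "g (\<tau> (Suc k)) \<in> V"
    and H: "connected H1" "connected H2" "V - C = H1 \<union> H2" "0 < d"
    and H1: "\<forall>s\<in>{\<tau> (Suc k) - d<..<\<tau> (Suc k)}. g s \<in> H1"
    and H2: "\<forall>s\<in>{\<tau> (Suc k)<..<\<tau> (Suc k) + d}. g s \<in> H2"
    using cross[of "Suc k" UNIV] k by auto
  have "g (\<tau> (Suc k)) \<in> C"
    using meet[of "Suc k"] \<sigma>_range[OF p_le[of "Suc k"]] k by (auto simp: path_image_def)
  note opp = halves_on_opposite_sides[OF XY V this H(3,1,2)]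
  have \<tau>: "\<tau> k < \<tau> (Suc k)" "\<tau> (Suc k) < \<tau> (Suc (Suc k))"
    using \<tau>_less[of k "Suc k"] \<tau>_less[of "Suc k" "Suc (Suc k)"] k by auto
  obtain s where s: "max (\<tau> k) (\<tau> (Suc k) - d) < s" "s < \<tau> (Suc k)"
    using dense[of "max (\<tau> k) (\<tau> (Suc k) - d)" "\<tau> (Suc k)"] \<tau> H(4) by auto
  obtain s' where s': "\<tau> (Suc k) < s'" "s' < min (\<tau> (Suc (Suc k))) (\<tau> (Suc k) + d)"
    using dense[of "\<tau> (Suc k)" "min (\<tau> (Suc (Suc k))) (\<tau> (Suc k) + d)"] \<tau> H(4) by auto
  have "g s \<in> arch k" "g s \<in> H1" using s H1 by (auto simp: arch_def)
  moreover have "g s' \<in> arch (Suc k)" "g s' \<in> H2" using s' H2 by (auto simp: arch_def)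
  moreover have "X \<inter> Y = {}" using XY by (simp add: two_sides_def)
  ultimately have "arch (Suc k) \<inter> Y \<noteq> {}" using opp X by blast
  then show ?thesis
    using connected_subset_side[OF two_sides_commute[OF XY]] arch_connected[of "Suc k"]
      arch_off_C[of "Suc k"] k by simp
qed

lemma arch_sides:
  obtains X Y where "two_sides C X Y"
    "\<And>k. k \<le> 2 * n \<Longrightarrow> arch k \<subseteq> (if even k then X else Y)"
proof -
  obtain w where w: "w \<in> arch 0" using arch_nonempty[of 0] by blast
  then have "w \<notin> C" using arch_off_C[of 0] by blast
  then obtain X Y where XY: "two_sides C X Y" "w \<in> X"
    using two_sides_containing[OF simple(1)] closing by (metis pathfinish_def pathstart_def)
  have "arch k \<subseteq> (if even k then X else Y)" if "k \<le> 2 * n" for k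
    using that
  proof (induction k)
    case 0
    show ?case using connected_subset_side[OF XY(1)] arch_connected[of 0] arch_off_C[of 0] w XY(2) by auto
  next
    case (Suc k)
    then show ?case
      using arch_sides_alternate[OF XY(1), of k] arch_sides_alternate[OF two_sides_commute[OF XY(1)], of k]
      by (auto split: if_splits)
  qed
  with XY(1) show thesis using that by blast
qed

text \<open>The labels of the left and of the right end of the \<open>k\<close>-th arch.\<close>

definition lo where "lo k = min (p k) (p (Suc k))"
definition hi where "hi k = max (p k) (p (Suc k))"

text \<open>
  The Jordan curve that consists of the \<open>k\<close>-th arch and of the part of \<open>c\<close> between its endpoints. The
  part of \<open>c\<close> is the one that does not pass through the base point in its interior.
\<close>

definition bay :: "nat \<Rightarrow> complex set" where
  "bay k = c ` {\<sigma> (lo k)..\<sigma> (hi k)} \<union> g ` {\<tau> k..\<tau> (Suc k)}"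

lemma lo_hi: "k \<le> 2 * n \<Longrightarrow> lo k < hi k \<and> hi k \<le> 2 * n + 1"
  using p_le[of k] p_le[of "Suc k"] p_eq_iff[of k "Suc k"] by (auto simp: lo_def hi_def)

lemma lo_0: "k \<le> 2 * n \<Longrightarrow> lo k = 0 \<Longrightarrow> k = 0"
  using p_ends p_eq_iff[of k 0] p_eq_iff[of "Suc k" 0] by (auto simp: lo_def min_def split: if_splits)

lemma hi_last: "k \<le> 2 * n \<Longrightarrow> hi k = 2 * n + 1 \<Longrightarrow> k = 2 * n"
  using p_ends p_eq_iff[of k "2 * n + 1"] p_eq_iff[of "Suc k" "2 * n + 1"]
  by (auto simp: hi_def max_def split: if_splits)

lemma bay_is_loop:
  assumes k: "k \<le> 2 * n" and n: "0 < n"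
  obtains e where "simple_path e" "pathfinish e = pathstart e" "path_image e = bay k"
proof -
  let ?a = "\<sigma> (lo k)" and ?b = "\<sigma> (hi k)" and ?s = "\<tau> k" and ?t = "\<tau> (Suc k)"
  have ab: "?a < ?b" "?a \<in> {0..1}" "?b \<in> {0..1}"
    using lo_hi[OF k] \<sigma>_less[of "lo k" "hi k"] \<sigma>_range[of "lo k"] \<sigma>_range[of "hi k"] by auto
  have st: "?s < ?t" "?s \<in> {0..1}" "?t \<in> {0..1}"
    using \<tau>_less[of k "Suc k"] \<tau>_range[of k] \<tau>_range[of "Suc k"] k by auto
  have "\<not> (lo k = 0 \<and> hi k = 2 * n + 1)" using lo_0[OF k] hi_last[OF k] n by auto
  then have "?a \<in> {0<..<1} \<or> ?b \<in> {0<..<1}"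
    using \<sigma>_inner[of "lo k"] \<sigma>_inner[of "hi k"] lo_hi[OF k] by auto
  then have ne: "c ?a \<noteq> c ?b"
    using simple_loop_inj[OF simple(1), of ?a ?b] simple_loop_inj[OF simple(1), of ?b ?a] ab by auto
  obtain u v where uv: "u \<in> {0..1}" "v \<in> {0..1}" "g u = c ?b" "g v = c ?a"
    "path_image (subpath u v g) = g ` {?s..?t}"
  proof (cases "p k = hi k")
    case True
    then have "p (Suc k) = lo k" by (auto simp: lo_def hi_def)
    then show thesis
      using that[of ?s ?t] st meet[of k] meet[of "Suc k"] k True by (simp add: path_image_subpath)
  next
    case False
    then have "p (Suc k) = hi k" "p k = lo k" by (auto simp: lo_def hi_def)
    then show thesis
      using that[of ?t ?s] st meet[of k] meet[of "Suc k"] k by (simp add: path_image_subpath)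
  qed
  have "x \<in> {c ?a, c ?b}" if x: "x \<in> c ` {?a..?b}" "x \<in> g ` {?s..?t}" for x
  proof -
    obtain s where s: "s \<in> {?s..?t}" "x = g s" using x(2) by blast
    have "x \<in> C" using x(1) ab by (force simp: path_image_def)
    then obtain m where m: "m \<le> 2 * n + 1" "s = \<tau> m" using meet_only[of s] s st by auto
    then have "m = k \<or> m = Suc k" using s \<tau>_le[of k m] \<tau>_le[of m "Suc k"] k by auto
    then have "p m = lo k \<or> p m = hi k" by (auto simp: lo_def hi_def)
    then show ?thesis using meet[OF m(1)] m(2) s(2) by auto
  qed
  then have inter: "c ` {?a..?b} \<inter> g ` {?s..?t} \<subseteq> {c ?a, c ?b}" by blast
  let ?e1 = "subpath ?a ?b c" and ?e2 = "subpath u v g"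
  have im: "path_image ?e1 = c ` {?a..?b}" using ab by (simp add: path_image_subpath)
  have "arc ?e1" "arc ?e2"
    using arc_simple_path_subpath[OF simple(1) ab(2,3)] arc_simple_path_subpath[OF simple(2) uv(1,2)]
      ne uv(3,4) by auto
  then have "simple_path (?e1 +++ ?e2)"
    using uv inter im by (intro simple_path_join_loop) (auto simp: pathstart_subpath pathfinish_subpath)
  moreover have "pathfinish (?e1 +++ ?e2) = pathstart (?e1 +++ ?e2)"
    using uv by (simp add: pathstart_subpath pathfinish_subpath)
  moreover have "path_image (?e1 +++ ?e2) = bay k"
    using uv im by (simp add: path_image_join pathstart_subpath pathfinish_subpath bay_def)
  ultimately show thesis using that by blast
qed

text \<open>
  An arch on the same side of \<open>c\<close> cannot end on the open part of \<open>c\<close> between \<open>lo k\<close> and \<open>hi k\<close> if it also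
  reaches the side \<open>P\<close> of the bay on which \<open>Y\<close> lies.
\<close>

lemma arch_not_into_bay:
  assumes k: "k \<le> 2 * n" and l: "l \<le> 2 * n" "l \<noteq> k" and u: "u = l \<or> u = Suc l"
    and inside: "lo k < p u" "p u < hi k"
    and C: "two_sides C X Y" "arch k \<subseteq> X" "arch l \<subseteq> X"
    and E: "two_sides (bay k) P Q" "Y \<inter> P \<noteq> {}" "arch l \<inter> P \<noteq> {}"
  shows False
proof -
  have u': "u \<le> 2 * n + 1" "p u \<le> 2 * n + 1" using u l p_le[of u] by auto
  have "u \<noteq> k" "u \<noteq> Suc k" using inside by (auto simp: lo_def hi_def)
  have "p u \<in> {1..2 * n}" using inside lo_hi[OF k] by auto
  then have ui: "u \<in> {1..2 * n}" using p_inner u' by simp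
  define A where "A = g ` {\<tau> k..\<tau> (Suc k)}"
  define B where "B = c ` {\<sigma> (lo k)..\<sigma> (hi k)}"
  define B' where "B' = c ` ({0..\<sigma> (lo k)} \<union> {\<sigma> (hi k)..1})"
  have bay: "bay k = B \<union> A" by (simp add: bay_def A_def B_def)
  have rng: "\<sigma> (lo k) \<in> {0..1}" "\<sigma> (hi k) \<in> {0..1}" "\<tau> k \<in> {0..1}" "\<tau> (Suc k) \<in> {0..1}"
    using \<sigma>_range lo_hi[OF k] \<tau>_range k by auto
  then have "{0..1} = {\<sigma> (lo k)..\<sigma> (hi k)} \<union> ({0..\<sigma> (lo k)} \<union> {\<sigma> (hi k)..1})" by auto
  then have CB: "C = B \<union> B'" unfolding path_image_def B_def B'_def by (metis image_Un)
  have closed: "closed A" "closed B'" unfolding A_def B'_def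
    using rng by (auto intro!: compact_imp_closed compact_continuous_image continuous_on_subset[OF path_g(1)]
      continuous_on_subset[OF path_g(2)] compact_Un)
  have "{\<tau> k..\<tau> (Suc k)} = {\<tau> k<..<\<tau> (Suc k)} \<union> {\<tau> k, \<tau> (Suc k)}"
    using \<tau>_le[of k "Suc k"] k by auto
  then have "A = arch k \<union> {g (\<tau> k), g (\<tau> (Suc k))}" by (simp add: A_def arch_def)
  moreover have gC: "g (\<tau> m) \<in> C" if "m \<le> 2 * n + 1" for m
    using meet[OF that] \<sigma>_range[OF p_le[OF that]] by (auto simp: path_image_def)
  ultimately have A: "A \<subseteq> arch k \<union> C" using k gC[of k] gC[of "Suc k"] by auto
  have XY: "X \<inter> Y = {}" "C \<inter> Y = {}" using C(1) by (auto simp: two_sides_def)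
  have q: "g (\<tau> u) = c (\<sigma> (p u))" using meet u' by simp
  have qB: "g (\<tau> u) \<in> B"
    using q inside \<sigma>_le[of "lo k" "p u"] \<sigma>_le[of "p u" "hi k"] lo_hi[OF k] u' by (auto simp: B_def)
  have qB': "g (\<tau> u) \<notin> B'"
  proof
    assume "g (\<tau> u) \<in> B'"
    then obtain s where s: "s \<in> {0..\<sigma> (lo k)} \<union> {\<sigma> (hi k)..1}" "g (\<tau> u) = c s"
      unfolding B'_def by blast
    then have "s = \<sigma> (p u)"
      using simple_loop_inj[OF simple(1), of s "\<sigma> (p u)"] q rng \<sigma>_inner[of "p u"] \<open>p u \<in> _\<close> by auto
    then show False
      using s(1) inside \<sigma>_less[of "lo k" "p u"] \<sigma>_less[of "p u" "hi k"] lo_hi[OF k] u' by auto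
  qed
  have qA: "g (\<tau> u) \<notin> A"
  proof
    assume "g (\<tau> u) \<in> A"
    then obtain s where s: "s \<in> {\<tau> k..\<tau> (Suc k)}" "g (\<tau> u) = g s" unfolding A_def by blast
    then have "s = \<tau> u"
      using simple_loop_inj[OF simple(2), of s "\<tau> u"] rng \<tau>_inner[OF ui] by auto
    then show False
      using s(1) \<tau>_le[of k u] \<tau>_le[of u "Suc k"] k u' \<open>u \<noteq> k\<close> \<open>u \<noteq> Suc k\<close> by auto
  qed
  have Fl: "arch l \<inter> A = {}"
  proof -
    have "g s \<noteq> g s'" if s: "s \<in> {\<tau> l<..<\<tau> (Suc l)}" "s' \<in> {\<tau> k..\<tau> (Suc k)}" for s s'
    proof
      assume "g s = g s'"
      have "s \<in> {0<..<1}" using s(1) \<tau>_range[of l] \<tau>_range[of "Suc l"] l by auto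
      then have "s' = s"
        using simple_loop_inj[OF simple(2), of s' s] s rng \<open>g s = g s'\<close> by auto
      then show False
        using s \<tau>_le[of "Suc l" k] \<tau>_le[of "Suc k" l] k l by (cases "l < k") auto
    qed
    then show ?thesis by (auto simp: arch_def A_def)
  qed
  have W: "open (- (B' \<union> A))" "g (\<tau> u) \<in> - (B' \<union> A)"
    using closed qA qB' open_Compl[OF closed_Un[OF closed(2,1)]] by auto
  obtain V H1 H2 d where V: "open V" "g (\<tau> u) \<in> V" "V \<subseteq> - (B' \<union> A)"
    and H: "V - C = H1 \<union> H2" "connected H1" "connected H2" "0 < d"
    and H1: "\<forall>s\<in>{\<tau> u - d<..<\<tau> u}. g s \<in> H1" and H2: "\<forall>s\<in>{\<tau> u<..<\<tau> u + d}. g s \<in> H2"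
    using cross[OF ui W] by blast
  have "\<exists>s \<in> {\<tau> l<..<\<tau> (Suc l)}. g s \<in> V"
  proof (cases "u = l")
    case True
    obtain s where s: "\<tau> l < s" "s < min (\<tau> (Suc l)) (\<tau> l + d)"
      using dense[of "\<tau> l" "min (\<tau> (Suc l)) (\<tau> l + d)"] \<tau>_less[of l "Suc l"] l H(4) by auto
    then have "g s \<in> H2" using H2 True by auto
    then show ?thesis using s H(1) by (intro bexI[of _ s]) auto
  next
    case False
    then have u: "u = Suc l" using u by simp
    obtain s where s: "max (\<tau> l) (\<tau> u - d) < s" "s < \<tau> u"
      using dense[of "max (\<tau> l) (\<tau> u - d)" "\<tau> u"] \<tau>_less[of l "Suc l"] l H(4) u by auto
    then have "g s \<in> H1" using H1 by auto
    then show ?thesis using s H(1) u by (intro bexI[of _ s]) auto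
  qed
  then have FV: "arch l \<inter> V \<noteq> {}" by (auto simp: arch_def)
  have FC: "arch l \<inter> C = {}" "arch k \<inter> C = {}" using arch_off_C k l by auto
  show False
  proof (rule arch_not_crossed[OF C(1) E(1) _ E(2) _ V(2,1) _ H(1-3) arch_connected[OF l(1)] C(3) _ FV E(3)])
    show "bay k \<inter> Y = {}" using A XY C(2) CB bay by blast
    show "g (\<tau> u) \<in> bay k" using qB bay by blast
    show "V \<inter> C = V \<inter> bay k" using V(3) CB bay by blast
    show "arch l \<inter> bay k = {}" using Fl FC CB bay by blast
  qed
qed

text \<open>
  Both the first and the last arch end at the base point, so that the general argument does not exclude
  that they cross there. Here the corner shows that the last arch and the final part of \<open>c\<close> lie on the
  same side of the bay of the first arch.
\<close>

lemma first_last_order: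
  assumes n: "0 < n"
  shows "p 1 < p (2 * n)"
proof (rule ccontr)
  assume "\<not> p 1 < p (2 * n)"
  moreover have "p 1 \<noteq> p (2 * n)" using p_eq_iff[of 1 "2 * n"] n by auto
  ultimately have less: "p (2 * n) < p 1" by simp
  have pos: "0 < p (2 * n)" using p_range[of "2 * n"] n by simp
  obtain X Y where XY: "two_sides C X Y"
    "\<And>k. k \<le> 2 * n \<Longrightarrow> arch k \<subseteq> (if even k then X else Y)"
    using arch_sides by blast
  have lh: "lo 0 = 0" "hi 0 = p 1" using p_ends by (auto simp: lo_def hi_def)
  \<comment> \<open>Up to this parameter, both loops have covered the bay of the first arch, but the last arch is not complete.\<close>
  define s0 where "s0 = max (\<sigma> (p 1)) (\<tau> (2 * n))"
  have s0: "s0 \<in> {0..<1}"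
    using \<sigma>_inner[of "p 1"] \<tau>_inner[of "2 * n"] p_range[of 1] n by (auto simp: s0_def)
  define C0 G0 where "C0 = c ` {0..s0}" and "G0 = g ` {0..s0}"
  obtain K where K: "connected K" "K \<inter> C0 = {}" "K \<inter> G0 = {}" "K \<inter> C \<noteq> {}" "K \<inter> path_image g \<noteq> {}"
    using corner[OF s0] unfolding C0_def G0_def by blast
  obtain w where w: "w \<in> K" "w \<in> C" using K(4) by blast
  obtain s where s: "s \<in> {0..1}" "g s \<in> K" using K(5) unfolding path_image_def by blast
  have "\<tau> 1 \<le> \<tau> (2 * n)" using \<tau>_le[of 1 "2 * n"] n by simp
  then have sub: "{\<sigma> (lo 0)..\<sigma> (hi 0)} \<subseteq> {0..s0}" "{\<tau> 0..\<tau> (Suc 0)} \<subseteq> {0..s0}"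
    by (auto simp: lh s0_def \<sigma>_ends \<tau>_ends)
  have "bay 0 \<subseteq> C0 \<union> G0"
    unfolding bay_def C0_def G0_def by (intro Un_mono image_mono sub)
  then have KE: "K \<inter> bay 0 = {}" using K(2,3) by blast
  obtain e where e: "simple_path e" "pathfinish e = pathstart e" "path_image e = bay 0"
    using bay_is_loop[of 0] n by blast
  obtain P Q where PQ: "two_sides (bay 0) P Q" "w \<in> P"
    using two_sides_containing[OF e(1,2), of w] KE w e(3) by auto
  have KP: "K \<subseteq> P" using connected_subset_side[OF PQ(1) K(1) KE] w(1) PQ(2) by blast
  have "open P" using PQ(1) by (simp add: two_sides_def)
  then have YP: "Y \<inter> P \<noteq> {}" using side_meets_nbhd(2)[OF XY(1) _ PQ(2) w(2)] by blast
  have G0: "g t \<in> G0" if "t \<in> {0..s0}" for t using that by (simp add: G0_def)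
  then have "s \<notin> {0..s0}" using s K(3) by blast
  moreover have "s \<noteq> 1"
  proof
    assume "s = 1"
    then have "g 0 \<in> K" using s closing(2) by simp
    moreover have "g 0 \<in> G0" using G0[of 0] s0 by simp
    ultimately show False using K(3) by blast
  qed
  ultimately have "s \<in> {\<tau> (2 * n)<..<\<tau> (Suc (2 * n))}"
    using s(1) \<tau>_ends(2) by (auto simp: s0_def)
  then have "g s \<in> arch (2 * n)" unfolding arch_def by (rule imageI)
  then have FP: "arch (2 * n) \<inter> P \<noteq> {}" using s(2) KP by blast
  show False
    using arch_not_into_bay[of 0 "2 * n" "2 * n" X Y P Q] XY(1) XY(2)[of 0] XY(2)[of "2 * n"]
      PQ(1) YP FP less pos n lh by simp
qed

lemma ends_noncrossing:
  assumes k: "k \<le> 2 * n" and l: "l \<le> 2 * n" "even (k + l)" "k \<noteq> l"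
    and uv: "u = l \<and> v = Suc l \<or> u = Suc l \<and> v = l"
    and u: "strictly_between (p k) (p (Suc k)) (p u)"
  shows "strictly_between (p k) (p (Suc k)) (p v)"
proof (rule ccontr)
  assume "\<not> strictly_between (p k) (p (Suc k)) (p v)"
  have n: "0 < n" using k l by (cases n) auto
  have inside: "lo k < p u" "p u < hi k" using u by (auto simp: strictly_between_def lo_def hi_def)
  have v1: "v \<le> 2 * n + 1" "p v \<le> 2 * n + 1" using uv l p_le[of v] by auto
  have "v \<noteq> k" "v \<noteq> Suc k" using uv l by auto
  then have "p v \<noteq> p k" "p v \<noteq> p (Suc k)" using p_eq_iff v1 k by auto
  then have out: "p v < lo k \<or> hi k < p v"
    using \<open>\<not> strictly_between _ _ _\<close> by (auto simp: strictly_between_def lo_def hi_def)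
  obtain X0 Y0 where XY0: "two_sides C X0 Y0"
    "\<And>k. k \<le> 2 * n \<Longrightarrow> arch k \<subseteq> (if even k then X0 else Y0)"
    using arch_sides by blast
  \<comment> \<open>The sides are named so that both arches lie in the first one.\<close>
  define X Y where "X = (if even k then X0 else Y0)" and "Y = (if even k then Y0 else X0)"
  have XY: "two_sides C X Y" using XY0(1) two_sides_commute by (auto simp: X_def Y_def)
  have kX: "arch k \<subseteq> X" and lX: "arch l \<subseteq> X" using XY0(2)[OF k] XY0(2)[OF l(1)] l(2) by (auto simp: X_def)
  let ?w = "g (\<tau> v)"
  have w: "?w = c (\<sigma> (p v))" using meet v1 by simp
  have wC: "?w \<in> C" using w \<sigma>_range[OF v1(2)] by (auto simp: path_image_def)
  \<comment> \<open>The other endpoint is not on the bay, so it determines the side on which the arch lies.\<close>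
  have "?w \<notin> bay k"
  proof (cases "v \<in> {1..2 * n}")
    case True
    have "p v \<in> {1..2 * n}" using p_range[OF True] .
    have "c s \<noteq> ?w" if s: "s \<in> {\<sigma> (lo k)..\<sigma> (hi k)}" for s
    proof
      assume "c s = ?w"
      then have "s = \<sigma> (p v)"
        using simple_loop_inj[OF simple(1), of s "\<sigma> (p v)"] s w \<sigma>_inner[OF \<open>p v \<in> _\<close>]
          \<sigma>_range[of "lo k"] \<sigma>_range[of "hi k"] lo_hi[OF k] by auto
      then show False
        using s out \<sigma>_le[of "lo k" "p v"] \<sigma>_le[of "p v" "hi k"] lo_hi[OF k] v1 by auto
    qed
    moreover have "g s \<noteq> ?w" if s: "s \<in> {\<tau> k..\<tau> (Suc k)}" for s
    proof
      assume "g s = ?w"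
      then have "s = \<tau> v"
        using simple_loop_inj[OF simple(2), of s "\<tau> v"] s \<tau>_inner[OF True]
          \<tau>_range[of k] \<tau>_range[of "Suc k"] k by auto
      then show False
        using s \<tau>_le[of k v] \<tau>_le[of v "Suc k"] k v1 \<open>v \<noteq> k\<close> \<open>v \<noteq> Suc k\<close> by auto
    qed
    ultimately show ?thesis unfolding bay_def Un_iff image_iff by metis
  next
    case False
    then have v: "v = 0 \<or> v = 2 * n + 1" using v1 by auto
    then have pv: "p v = v" using p_ends by auto
    have "\<not> (lo k = 0 \<and> v = 2 * n + 1)"
    proof
      assume *: "lo k = 0 \<and> v = 2 * n + 1"
      then have "k = 0" "u = 2 * n" using lo_0[OF k] uv l by auto
      then show False
        using inside first_last_order[OF n] p_ends p_le[of 1] by (simp add: hi_def)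
    qed
    moreover have "\<not> (hi k = 2 * n + 1 \<and> v = 0)"
    proof
      assume *: "hi k = 2 * n + 1 \<and> v = 0"
      then have "k = 2 * n" "u = 1" using hi_last[OF k] uv l by auto
      then show False
        using inside first_last_order[OF n] p_ends p_le[of "2 * n"] by (simp add: lo_def)
    qed
    ultimately have lh: "lo k \<in> {1..2 * n}" "hi k \<in> {1..2 * n}"
      using v pv out lo_hi[OF k] by auto
    have "p k \<in> {1..2 * n}" "p (Suc k) \<in> {1..2 * n}" using lh by (auto simp: lo_def hi_def)
    then have kk: "k \<in> {1..2 * n}" "Suc k \<in> {1..2 * n}"
      using p_inner[of k] p_inner[of "Suc k"] k by auto
    have w0: "?w = c 0" "?w = g 0"
      using w pv v \<sigma>_ends \<tau>_ends closing by auto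
    have "c s \<noteq> ?w" if s: "s \<in> {\<sigma> (lo k)..\<sigma> (hi k)}" for s
      using simple_loop_inj[OF simple(1), of 0 s] s w0 \<sigma>_inner[OF lh(1)] \<sigma>_inner[OF lh(2)] by auto
    moreover have "g s \<noteq> ?w" if s: "s \<in> {\<tau> k..\<tau> (Suc k)}" for s
      using simple_loop_inj[OF simple(2), of 0 s] s w0(2) \<tau>_inner[OF kk(1)] \<tau>_inner[OF kk(2)]
      by auto
    ultimately show ?thesis unfolding bay_def Un_iff image_iff by metis
  qed
  moreover obtain e where e: "simple_path e" "pathfinish e = pathstart e" "path_image e = bay k"
    using bay_is_loop[OF k n] by blast
  ultimately obtain P Q where PQ: "two_sides (bay k) P Q" "?w \<in> P"
    using two_sides_containing[OF e(1,2), of ?w] by auto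
  have "open P" using PQ(1) by (simp add: two_sides_def)
  then have YP: "Y \<inter> P \<noteq> {}" using side_meets_nbhd(2)[OF XY _ PQ(2) wC] by blast
  have \<tau>l: "\<tau> l < \<tau> (Suc l)" using \<tau>_less[of l "Suc l"] l by simp
  have "?w \<in> closure (arch l)"
  proof -
    have "{\<tau> l..\<tau> (Suc l)} \<subseteq> {0..1}" using \<tau>_range[of l] \<tau>_range[of "Suc l"] l by auto
    then have "continuous_on (closure {\<tau> l<..<\<tau> (Suc l)}) g"
      using \<tau>l by (auto intro: continuous_on_subset[OF path_g(1)])
    then have "g ` closure {\<tau> l<..<\<tau> (Suc l)} \<subseteq> closure (arch l)"
      unfolding arch_def by (rule image_closure_subset[OF _ closed_closure closure_subset])
    moreover have "\<tau> v \<in> closure {\<tau> l<..<\<tau> (Suc l)}" using \<tau>l uv by auto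
    ultimately show ?thesis by blast
  qed
  then have FP: "arch l \<inter> P \<noteq> {}"
    using open_Int_closure_eq_empty[OF \<open>open P\<close>, of "arch l"] PQ(2) by blast
  show False
    using arch_not_into_bay[OF k l(1) _ _ inside XY kX lX PQ(1) YP FP] l(3) uv by auto
qed

lemma p_noncrossing: "noncrossing_permutation n p"
proof
  fix k l assume kl: "k \<le> 2 * n" "l \<le> 2 * n" "even (k + l)" "k \<noteq> l"
  show "strictly_between (p k) (p (Suc k)) (p l) \<longleftrightarrow> strictly_between (p k) (p (Suc k)) (p (Suc l))"
    using ends_noncrossing[OF kl, of l "Suc l"] ends_noncrossing[OF kl, of "Suc l" l] by blast
qed (use p_bij p_ends in auto)

end

section \<open>Closing up an open meander\<close>

text \<open>The rank of an element is its position in the increasing enumeration, counted from \<open>1\<close>.\<close>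

lemma nth_rank:
  fixes A :: "'a :: linorder set"
  assumes "finite A" "x \<in> A"
  shows "card {y \<in> A. y \<le> x} \<in> {1..card A}"
    and "sorted_list_of_set A ! (card {y \<in> A. y \<le> x} - 1) = x"
proof -
  define xs where "xs = sorted_list_of_set A"
  have xs: "set xs = A" "length xs = card A" "sorted_wrt (<) xs"
    using assms(1) by (simp_all add: xs_def)
  obtain i where i: "i < length xs" "xs ! i = x"
    using assms(2) xs(1) by (metis in_set_conv_nth)
  have less: "xs ! j \<le> xs ! i \<longleftrightarrow> j \<le> i" if "j < length xs" for j
    using sorted_wrt_nth_less[OF xs(3), of i j] sorted_wrt_nth_less[OF xs(3), of j i] i(1) that
    by (metis leD leI less_imp_le nat_neq_iff)
  have "{y \<in> A. y \<le> x} = (!) xs ` {..i}"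
  proof (intro equalityI subsetI)
    fix y assume "y \<in> {y \<in> A. y \<le> x}"
    then obtain j where "j < length xs" "xs ! j = y" "y \<le> x"
      using xs(1) by (metis (no_types, lifting) in_set_conv_nth mem_Collect_eq)
    then show "y \<in> (!) xs ` {..i}" using less[of j] i(2) by auto
  next
    fix y assume "y \<in> (!) xs ` {..i}"
    then obtain j where "j \<le> i" "y = xs ! j" by auto
    then show "y \<in> {y \<in> A. y \<le> x}" using less[of j] i xs(1) nth_mem[of j xs] by auto
  qed
  moreover have "inj_on ((!) xs) {..i}"
    using i(1) by (intro inj_on_nth) (auto simp: xs_def)
  ultimately have "card {y \<in> A. y \<le> x} = Suc i" by (simp add: card_image)
  then show "card {y \<in> A. y \<le> x} \<in> {1..card A}"
    and "sorted_list_of_set A ! (card {y \<in> A. y \<le> x} - 1) = x"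
    using i xs(2) by (simp_all add: xs_def)
qed

text \<open>
  The elements of a finite set \<open>A\<close> of parameters in \<open>{0<..<1}\<close> in increasing order, preceded by \<open>0\<close> and
  followed by \<open>1\<close>. The parameter \<open>x\<close> of the middle path in \<open>f1 +++ (f2 +++ f3)\<close> is the parameter
  \<open>(2 + x) / 4\<close> of the joined path.
\<close>

definition stops :: "real set \<Rightarrow> nat \<Rightarrow> real" where
  "stops A k = (if k = 0 then 0 else if k \<le> card A then (2 + sorted_list_of_set A ! (k - 1)) / 4 else 1)"

lemma stops_strict_mono:
  assumes A: "finite A" "A \<subseteq> {0<..<1}"
  shows "strict_mono_on {0..card A + 1} (stops A)"
proof (rule strict_mono_onI)
  fix i j assume ij: "i \<in> {0..card A + 1}" "j \<in> {0..card A + 1}" "i < j"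
  let ?xs = "sorted_list_of_set A"
  have "?xs ! k \<in> A" if "k < card A" for k
    using that A(1) by (metis nth_mem set_sorted_list_of_set length_sorted_list_of_set)
  then have rng: "?xs ! k \<in> {0<..<1}" if "k < card A" for k using A(2) that by blast
  have mid: "0 < stops A k \<and> stops A k < 1" if "k \<in> {1..card A}" for k
  proof -
    have "k - 1 < card A" using that by auto
    then show ?thesis using rng[of "k - 1"] that by (auto simp: stops_def)
  qed
  consider "i = 0" "j \<le> card A" | "i = 0" "j = card A + 1"
    | "i \<in> {1..card A}" "j \<in> {1..card A}" | "i \<in> {1..card A}" "j = card A + 1"
    using ij by fastforce
  then show "stops A i < stops A j"
  proof cases
    case 3
    then have "?xs ! (i - 1) < ?xs ! (j - 1)"
      using ij(3) by (intro sorted_wrt_nth_less[where P = "(<)"]) auto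
    then show ?thesis using 3 by (simp add: stops_def)
  qed (use mid[of i] mid[of j] ij in \<open>auto simp: stops_def\<close>)
qed

lemma simple_path_join_three:
  assumes "arc f1" "arc f2" "arc f3"
    and "pathfinish f1 = pathstart f2" "pathfinish f2 = pathstart f3" "pathfinish f3 = pathstart f1"
    and "path_image f1 \<inter> path_image f2 \<subseteq> {pathstart f2}"
      "path_image f2 \<inter> path_image f3 \<subseteq> {pathstart f3}"
      "path_image f3 \<inter> path_image f1 \<subseteq> {pathstart f1}"
  shows "simple_path (f1 +++ (f2 +++ f3))"
    and "path_image (f1 +++ (f2 +++ f3)) = path_image f1 \<union> path_image f2 \<union> path_image f3"
proof -
  show im: "path_image (f1 +++ (f2 +++ f3)) = path_image f1 \<union> path_image f2 \<union> path_image f3"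
    using assms by (simp add: path_image_join Un_assoc)
  have "arc (f2 +++ f3)" using assms by (simp add: arc_join)
  then show "simple_path (f1 +++ (f2 +++ f3))"
    using assms by (intro simple_path_join_loop) (auto simp: path_image_join)
qed

text \<open>
  The crossing point \<open>z\<close> cuts both closing arcs into two. The loop \<open>c\<close> runs from \<open>z\<close> to \<open>a\<close>, along the
  segment to \<open>b\<close> and back to \<open>z\<close>; the loop \<open>g\<close> runs from \<open>z\<close> to the start of \<open>\<gamma>\<close>, along \<open>\<gamma>\<close> and
  back to \<open>z\<close>. They are simple, and at \<open>z\<close> they exchange the two branches of the crossing, so that
  they only touch.
\<close>

lemma meandric_permutation_noncrossing:
  assumes om: "open_meander n a b \<gamma>" and cl: "closable a b \<gamma>"
  shows "noncrossing_permutation n (meandric_permutation n a b \<gamma>)"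
proof -
  define L where "L = closed_segment a b"
  define G where "G = path_image \<gamma>"
  define X where "X = intersection_points a b \<gamma>"
  have ab: "Im a = Im b" "Re a < Re b" and \<gamma>: "arc \<gamma>"
    and off: "a \<notin> G" "b \<notin> G" "\<gamma> 0 \<notin> L" "\<gamma> 1 \<notin> L"
    and X: "finite X" "card X = 2 * n" "X = G \<inter> L"
    and crX: "\<And>q. q \<in> X \<Longrightarrow> crosses_transversally_at L G q"
    using om by (auto simp: open_meander_def L_def G_def X_def intersection_points_def
      pathstart_def pathfinish_def)
  obtain \<beta> \<alpha> z where \<beta>: "arc \<beta>" "\<beta> 0 = b" "\<beta> 1 = \<gamma> 0" and \<alpha>: "arc \<alpha>" "\<alpha> 0 = \<gamma> 1" "\<alpha> 1 = a"
    and \<beta>LG: "path_image \<beta> \<inter> (L \<union> G) = {b, \<gamma> 0}"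
    and \<alpha>LG: "path_image \<alpha> \<inter> (L \<union> G) = {\<gamma> 1, a}"
    and \<beta>\<alpha>: "path_image \<beta> \<inter> path_image \<alpha> = {z}"
    and crz: "crosses_transversally_at (path_image \<beta>) (path_image \<alpha>) z"
    using cl unfolding closable_def pathstart_def pathfinish_def L_def[symmetric] G_def[symmetric]
    by (elim exE conjE) (rule that)
  have ends: "a \<in> L" "b \<in> L" "\<gamma> 0 \<in> G" "\<gamma> 1 \<in> G" by (auto simp: L_def G_def path_image_def)
  have ne: "a \<noteq> b" "\<gamma> 0 \<noteq> \<gamma> 1" using ab arc_inj[OF \<gamma>, of 0 1] by auto

  have meetL: "path_image \<beta> \<inter> L \<subseteq> {b}" "path_image \<alpha> \<inter> L \<subseteq> {a}"
    and meetG: "path_image \<beta> \<inter> G \<subseteq> {\<gamma> 0}" "path_image \<alpha> \<inter> G \<subseteq> {\<gamma> 1}"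
  proof -
    have "x \<in> {b, \<gamma> 0}" if "x \<in> path_image \<beta>" "x \<in> L \<union> G" for x using \<beta>LG that by blast
    moreover have "x \<in> {\<gamma> 1, a}" if "x \<in> path_image \<alpha>" "x \<in> L \<union> G" for x
      using \<alpha>LG that by blast
    ultimately show "path_image \<beta> \<inter> L \<subseteq> {b}" "path_image \<alpha> \<inter> L \<subseteq> {a}"
      "path_image \<beta> \<inter> G \<subseteq> {\<gamma> 0}" "path_image \<alpha> \<inter> G \<subseteq> {\<gamma> 1}"
      using off by fastforce+
  qed
  obtain r s where r: "r \<in> {0..1}" "\<beta> r = z" and s: "s \<in> {0..1}" "\<alpha> s = z"
  proof -
    have "z \<in> path_image \<beta>" "z \<in> path_image \<alpha>" using \<beta>\<alpha> by blast+
    then show thesis using that unfolding path_image_def by (elim imageE) metis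
  qed
  have zLG: "z \<notin> L \<union> G"
  proof
    assume "z \<in> L \<union> G"
    then have "z \<in> {b, \<gamma> 0} \<inter> {\<gamma> 1, a}" using \<beta>LG \<alpha>LG \<beta>\<alpha> by blast
    then show False using ne off ends by auto
  qed
  have r01: "0 < r" "r < 1"
    using r zLG \<beta> ends by (auto simp: order.order_iff_strict)
  have s01: "0 < s" "s < 1"
    using s zLG \<alpha> ends by (auto simp: order.order_iff_strict)

  \<comment> \<open>The index 1 marks the part of a closing arc before the crossing point, the index 2 the part after it.\<close>
  define \<beta>1 \<beta>2 \<alpha>1 \<alpha>2 where "\<beta>1 = subpath 0 r \<beta>" and "\<beta>2 = subpath r 1 \<beta>"
    and "\<alpha>1 = subpath 0 s \<alpha>" and "\<alpha>2 = subpath s 1 \<alpha>"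
  define B1 B2 A1 A2 where "B1 = \<beta> ` {0..r}" and "B2 = \<beta> ` {r..1}"
    and "A1 = \<alpha> ` {0..s}" and "A2 = \<alpha> ` {s..1}"
  have im: "path_image \<beta>1 = B1" "path_image \<beta>2 = B2" "path_image \<alpha>1 = A1" "path_image \<alpha>2 = A2"
    using r01 s01 by (simp_all add: path_image_subpath \<beta>1_def \<beta>2_def \<alpha>1_def \<alpha>2_def B1_def B2_def A1_def A2_def)
  have arcs: "arc \<beta>1" "arc \<beta>2" "arc \<alpha>1" "arc \<alpha>2"
    unfolding \<beta>1_def \<beta>2_def \<alpha>1_def \<alpha>2_def
    using r01 s01 \<beta>(1) \<alpha>(1) by (auto intro!: arc_subpath_arc)
  have se: "pathstart \<beta>1 = b" "pathfinish \<beta>1 = z" "pathstart \<beta>2 = z" "pathfinish \<beta>2 = \<gamma> 0"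
    "pathstart \<alpha>1 = \<gamma> 1" "pathfinish \<alpha>1 = z" "pathstart \<alpha>2 = z" "pathfinish \<alpha>2 = a"
    "pathstart \<gamma> = \<gamma> 0" "pathfinish \<gamma> = \<gamma> 1"
    using r s \<beta> \<alpha> by (simp_all add: \<beta>1_def \<beta>2_def \<alpha>1_def \<alpha>2_def pathstart_def pathfinish_def subpath_def)
  have sub: "B1 \<subseteq> path_image \<beta>" "B2 \<subseteq> path_image \<beta>" "A1 \<subseteq> path_image \<alpha>" "A2 \<subseteq> path_image \<alpha>"
    using r01 s01 unfolding B1_def B2_def A1_def A2_def path_image_def by (auto intro!: image_mono)
  have zz: "B1 \<inter> B2 \<subseteq> {z}" "A1 \<inter> A2 \<subseteq> {z}"
    using arc_inj[OF \<beta>(1)] arc_inj[OF \<alpha>(1)] r01 s01 r(2) s(2)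
    by (force simp: B1_def B2_def A1_def A2_def)+
  have "\<beta> 1 \<notin> B1" "\<beta> 0 \<notin> B2" "\<alpha> 1 \<notin> A1" "\<alpha> 0 \<notin> A2"
    using arc_inj[OF \<beta>(1)] arc_inj[OF \<alpha>(1)] r01 s01
    by (force simp: B1_def B2_def A1_def A2_def)+
  then have far: "\<gamma> 0 \<notin> B1" "b \<notin> B2" "a \<notin> A1" "\<gamma> 1 \<notin> A2"
    by (simp_all add: \<beta>(2,3) \<alpha>(2,3))

  let ?l = "linepath a b"
  define c where "c = \<alpha>2 +++ (?l +++ \<beta>1)"
  define g where "g = \<beta>2 +++ (\<gamma> +++ \<alpha>1)"
  have c: "simple_path c" "path_image c = A2 \<union> L \<union> B1"
  proof -
    have "A2 \<inter> L \<subseteq> {a}" "L \<inter> B1 \<subseteq> {b}" "B1 \<inter> A2 \<subseteq> {z}"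
      using sub meetL \<beta>\<alpha> by blast+
    then show "simple_path c" "path_image c = A2 \<union> L \<union> B1"
      using simple_path_join_three[OF arcs(4) arc_linepath[OF ne(1)] arcs(1)] im se
      by (simp_all add: c_def L_def)
  qed
  have g: "simple_path g" "path_image g = B2 \<union> G \<union> A1"
  proof -
    have "B2 \<inter> G \<subseteq> {\<gamma> 0}" "G \<inter> A1 \<subseteq> {\<gamma> 1}" "A1 \<inter> B2 \<subseteq> {z}"
      using sub meetG \<beta>\<alpha> by blast+
    then show "simple_path g" "path_image g = B2 \<union> G \<union> A1"
      using simple_path_join_three[OF arcs(2) \<gamma> arcs(3)] im se by (simp_all add: g_def G_def)
  qed
  have ends0: "c 0 = z" "c 1 = z" "g 0 = z" "g 1 = z"
    using se by (simp_all add: c_def g_def joinpaths_def pathstart_def pathfinish_def)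
  have c_mid: "c ((2 + x) / 4) = ?l x" if "0 < x" "x < 1" for x
    using that by (simp add: c_def joinpaths_def field_simps)
  have g_mid: "g ((2 + x) / 4) = \<gamma> x" if "0 < x" "x < 1" for x
    using that by (simp add: g_def joinpaths_def field_simps)
  have c_first: "c ` {0..1/2} \<subseteq> A2" and g_first: "g ` {0..1/2} \<subseteq> B2"
    unfolding im(2,4)[symmetric] path_image_def c_def g_def joinpaths_def by auto
  have common: "path_image c \<inter> path_image g \<subseteq> insert z X"
  proof
    fix x assume x: "x \<in> path_image c \<inter> path_image g"
    show "x \<in> insert z X"
    proof (cases "x \<in> path_image \<beta> \<inter> path_image \<alpha> \<or> x \<in> L \<inter> G")
      case False
      then have "x \<in> A2 \<inter> G \<or> x \<in> A2 \<inter> A1 \<or> x \<in> L \<inter> B2 \<or> x \<in> L \<inter> A1 \<or> x \<in> B1 \<inter> B2 \<or> x \<in> B1 \<inter> G"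
        using x sub unfolding c g by blast
      then show ?thesis using sub meetL meetG zz far by blast
    qed (use \<beta>\<alpha> X(3) in auto)
  qed

  define \<Lambda> where "\<Lambda> = {x \<in> {0..1}. ?l x \<in> G}"
  define T where "T = {t \<in> {0..1}. \<gamma> t \<in> L}"
  have bij\<Lambda>: "bij_betw ?l \<Lambda> X"
  proof (rule bij_betw_imageI)
    show "inj_on ?l \<Lambda>" using arc_linepath[OF ne(1)] unfolding arc_def \<Lambda>_def
      by (elim conjE inj_on_subset) auto
    have "L = ?l ` {0..1}" unfolding L_def path_image_linepath[symmetric] path_image_def ..
    then show "?l ` \<Lambda> = X" unfolding X(3) \<Lambda>_def by auto
  qed
  have bijT: "bij_betw \<gamma> T X"
  proof (rule bij_betw_imageI)
    show "inj_on \<gamma> T" using \<gamma> unfolding arc_def T_def by (elim conjE inj_on_subset) auto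
    show "\<gamma> ` T = X" unfolding X(3) G_def path_image_def T_def by auto
  qed
  have fin: "finite \<Lambda>" "finite T" "card \<Lambda> = 2 * n" "card T = 2 * n"
    using bij_betw_finite[OF bij\<Lambda>] bij_betw_finite[OF bijT] bij_betw_same_card[OF bij\<Lambda>]
      bij_betw_same_card[OF bijT] X by auto
  have "0 \<notin> \<Lambda>" "1 \<notin> \<Lambda>" "0 \<notin> T" "1 \<notin> T" using off by (auto simp: \<Lambda>_def T_def linepath_0' linepath_1')
  then have open01: "\<Lambda> \<subseteq> {0<..<1}" "T \<subseteq> {0<..<1}"
    by (auto simp: \<Lambda>_def T_def order.order_iff_strict)
  have label: "intersection_label a b \<gamma> (?l x) = card {y \<in> \<Lambda>. y \<le> x}" if "x \<in> \<Lambda>" for x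
  proof -
    have mono: "Re (?l y) \<le> Re (?l x) \<longleftrightarrow> y \<le> x" for y
    proof -
      have "Re (?l x) - Re (?l y) = (x - y) * (Re b - Re a)"
        by (simp add: linepath_def algebra_simps)
      then show ?thesis using ab(2)
        by (metis diff_ge_0_iff_ge zero_le_mult_iff diff_gt_0_iff_gt less_le_not_le)
    qed
    have "bij_betw ?l {y \<in> \<Lambda>. y \<le> x} {q \<in> X. Re q \<le> Re (?l x)}"
      using bij\<Lambda> mono by (auto simp: bij_betw_def inj_on_def)
    then show ?thesis by (simp add: intersection_label_def X_def bij_betw_same_card)
  qed
  define p where "p = meandric_permutation n a b \<gamma>"
  define \<sigma> \<tau> where "\<sigma> = stops \<Lambda>" and "\<tau> = stops T"
  define t where "t k = sorted_list_of_set T ! (k - 1)" for k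
  have t: "t k \<in> T" "t k \<in> {0<..<1}" "\<tau> k = (2 + t k) / 4" if "k \<in> {1..2 * n}" for k
  proof -
    show "t k \<in> T" unfolding t_def using that fin
      by (metis (no_types) set_sorted_list_of_set nth_mem length_sorted_list_of_set
          atLeastAtMost_iff less_le_trans diff_less less_one)
    then show "t k \<in> {0<..<1}" using open01(2) by blast
    show "\<tau> k = (2 + t k) / 4" using that fin by (auto simp: \<tau>_def stops_def t_def)
  qed
  have g\<tau>: "g (\<tau> k) = \<gamma> (t k)" if "k \<in> {1..2 * n}" for k
    unfolding t(3)[OF that] using t(2)[OF that] by (intro g_mid) auto
  have p: "p k \<in> {1..2 * n}" "c (\<sigma> (p k)) = \<gamma> (t k)" if k: "k \<in> {1..2 * n}" for k
  proof -
    have "\<gamma> (t k) \<in> X" using bijT t(1)[OF k] by (auto simp: bij_betw_def)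
    then obtain x where x: "x \<in> \<Lambda>" "\<gamma> (t k) = ?l x" using bij\<Lambda> by (auto simp: bij_betw_def)
    have pk: "p k = card {y \<in> \<Lambda>. y \<le> x}"
      using k x label[OF x(1)] by (simp add: p_def meandric_permutation_def t_def T_def L_def)
    show rng: "p k \<in> {1..2 * n}" using nth_rank(1)[OF fin(1) x(1)] fin(3) pk by simp
    have \<sigma>: "\<sigma> (p k) = (2 + x) / 4"
      using rng fin(3) nth_rank(2)[OF fin(1) x(1)] pk by (simp add: \<sigma>_def stops_def)
    have "x \<in> {0<..<1}" using x(1) open01(1) by blast
    then show "c (\<sigma> (p k)) = \<gamma> (t k)" unfolding \<sigma> x(2) by (intro c_mid) auto
  qed
  have contg: "continuous_on {0..1} g" and contc: "continuous_on {0..1} c"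
    using g(1) c(1) by (auto simp: simple_path_def path_def)

  interpret touching_loops n p c g \<sigma> \<tau>
  proof
    show "simple_path c" "simple_path g" by fact+
    show "c 1 = c 0" "g 1 = g 0" by (simp_all add: ends0)
    show "p k \<in> {1..2 * n}" if "k \<in> {1..2 * n}" for k using p that by blast
    show "p 0 = 0" "p (2 * n + 1) = 2 * n + 1" by (simp_all add: p_def meandric_permutation_def)
    show "strict_mono_on {0..2 * n + 1} \<sigma>" "strict_mono_on {0..2 * n + 1} \<tau>"
      using stops_strict_mono[OF fin(1) open01(1)] stops_strict_mono[OF fin(2) open01(2)] fin
      by (simp_all add: \<sigma>_def \<tau>_def)
    show "\<sigma> 0 = 0" "\<tau> 0 = 0" "\<sigma> (2 * n + 1) = 1" "\<tau> (2 * n + 1) = 1"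
      using fin by (simp_all add: \<sigma>_def \<tau>_def stops_def)
    then show "g (\<tau> k) = c (\<sigma> (p k))" if "k \<le> 2 * n + 1" for k
    proof (cases "k \<in> {1..2 * n}")
      case True
      then show ?thesis using p(2) g\<tau> by simp
    next
      case False
      then have "k = 0 \<or> k = 2 * n + 1" using that by auto
      then show ?thesis
        using \<open>\<sigma> 0 = 0\<close> \<open>\<tau> 0 = 0\<close> \<open>\<sigma> (2 * n + 1) = 1\<close> \<open>\<tau> (2 * n + 1) = 1\<close>
        by (auto simp: p_def meandric_permutation_def ends0)
    qed
    show "\<exists>k\<le>2 * n + 1. x = \<tau> k" if x: "x \<in> {0..1}" "g x \<in> path_image c" for x
    proof -
      have "g x \<in> path_image g" using x(1) by (simp add: path_image_def)
      then consider "g x = z" | "g x \<in> X" using common x(2) by blast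
      then show ?thesis
      proof cases
        case 1
        then have "x = 0 \<or> x = 1"
          using simple_loop_inj[OF g(1), of 0 x] ends0(3) x(1) by force
        then show ?thesis using \<open>\<tau> 0 = 0\<close> \<open>\<tau> (2 * n + 1) = 1\<close> by (metis le_refl zero_le)
      next
        case 2
        then obtain y where y: "y \<in> T" "g x = \<gamma> y" using bijT by (auto simp: bij_betw_def)
        define k where "k = card {y' \<in> T. y' \<le> y}"
        have k: "k \<in> {1..2 * n}" "t k = y"
          using nth_rank[OF fin(2) y(1)] fin(4) by (simp_all add: k_def t_def)
        have "g x = g (\<tau> k)" using g\<tau>[OF k(1)] k(2) y(2) by simp
        moreover have "\<tau> k \<in> {0<..<1}" unfolding t(3)[OF k(1)] using t(2)[OF k(1)] by simp
        ultimately have "x = \<tau> k" using simple_loop_inj[OF g(1) x(1)] by blast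
        then show ?thesis using k(1) by (intro exI[of _ k]) simp
      qed
    qed
    show "\<exists>V H1 H2 d. open V \<and> g (\<tau> k) \<in> V \<and> V \<subseteq> W \<and> connected H1 \<and> connected H2 \<and>
        V - path_image c = H1 \<union> H2 \<and> 0 < d \<and>
        (\<forall>x\<in>{\<tau> k - d<..<\<tau> k}. g x \<in> H1) \<and> (\<forall>x\<in>{\<tau> k<..<\<tau> k + d}. g x \<in> H2)"
      if k: "k \<in> {1..2 * n}" and W: "open W" "g (\<tau> k) \<in> W" for k W
    proof -
      note tk = t[OF k]
      note gt = g\<tau>[OF k]
      have qX: "\<gamma> (t k) \<in> X" using bijT tk(1) by (auto simp: bij_betw_def)
      have "closed A2" "closed B1"
        using closed_arc_image[OF arcs(4)] closed_arc_image[OF arcs(1)] im by simp_all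
      then have "open (W \<inter> - (A2 \<union> B1))" using W(1) by (intro open_Int open_Compl closed_Un)
      moreover have "\<gamma> (t k) \<in> W \<inter> - (A2 \<union> B1)"
      proof -
        have "\<gamma> (t k) \<notin> A2" "\<gamma> (t k) \<notin> B1" using qX X(3) sub meetL meetG off by blast+
        then show ?thesis using W(2) gt by simp
      qed
      moreover have "crosses_transversally_at L (path_image \<gamma>) (\<gamma> (t k))"
        using crX[OF qX] by (simp add: G_def)
      ultimately obtain V H1 H2 d where V: "open V" "\<gamma> (t k) \<in> V" "V \<subseteq> W \<inter> - (A2 \<union> B1)"
        and H: "connected H1" "connected H2" "V - L = H1 \<union> H2" "d > 0"
        and H1: "\<And>x. x \<in> {t k - d<..<t k} \<Longrightarrow> \<gamma> x \<in> H1"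
        and H2: "\<And>x. x \<in> {t k<..<t k + d} \<Longrightarrow> \<gamma> x \<in> H2"
        using crossing_neighbourhood[of L \<gamma> "t k"] \<gamma> tk(2)
        by (metis (no_types, lifting) greaterThanLessThan_iff)
      \<comment> \<open>The radius of the interval for the curve itself, scaled to the parameters of the loop and kept inside its middle piece.\<close>
      define d' where "d' = min d (min (t k) (1 - t k)) / 4"
      have d': "4 * d' \<le> d" "4 * d' \<le> t k" "4 * d' \<le> 1 - t k" by (auto simp: d'_def)
      have \<tau>4: "4 * \<tau> k = 2 + t k" unfolding tk(3) by simp
      have near: "g x = \<gamma> (4 * x - 2)" if "\<bar>x - \<tau> k\<bar> < d'" for x
      proof -
        have "0 < 4 * x - 2" "4 * x - 2 < 1" using that d'(2,3) \<tau>4 by linarith+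
        then show ?thesis using g_mid[of "4 * x - 2"] by simp
      qed
      have "0 < d'" using H(4) tk(2) by (simp add: d'_def)
      moreover have "g x \<in> H1" if "x \<in> {\<tau> k - d'<..<\<tau> k}" for x
      proof -
        have "4 * x - 2 \<in> {t k - d<..<t k}" using that \<tau>4 d'(1) by auto
        then show ?thesis using near[of x] H1 that by auto
      qed
      moreover have "g x \<in> H2" if "x \<in> {\<tau> k<..<\<tau> k + d'}" for x
      proof -
        have "4 * x - 2 \<in> {t k<..<t k + d}" using that \<tau>4 d'(1) by auto
        then show ?thesis using near[of x] H2 that by auto
      qed
      moreover have "V - path_image c = H1 \<union> H2" using V(3) H(3) c(2) by blast
      moreover have "V \<subseteq> W" using V(3) by blast
      ultimately show ?thesis using V(1,2) H(1,2) gt by metis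
    qed
    show "\<exists>K. connected K \<and> K \<inter> c ` {0..x} = {} \<and> K \<inter> g ` {0..x} = {} \<and>
        K \<inter> path_image c \<noteq> {} \<and> K \<inter> path_image g \<noteq> {}" if x: "x \<in> {0..<1}" for x
    proof -
      \<comment> \<open>The corner has to avoid the outgoing closing arcs and the compact rest of the loops up to the parameter.\<close>
      define C1 G1 where "C1 = c ` {1/2..x}" and "G1 = g ` {1/2..x}"
      have "{0..x} \<subseteq> {0..1/2} \<union> {1/2..x}" by auto
      then have split: "f ` {0..x} \<subseteq> f ` {0..1/2} \<union> f ` {1/2..x}" for f :: "real \<Rightarrow> complex"
        unfolding image_Un[symmetric] by (rule image_mono)
      have cg: "c ` {0..x} \<subseteq> A2 \<union> C1" "g ` {0..x} \<subseteq> B2 \<union> G1"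
        using order_trans[OF split Un_mono[OF c_first order_refl]]
          order_trans[OF split Un_mono[OF g_first order_refl]]
        by (simp_all only: C1_def G1_def)
      have "closed C1" "closed G1" unfolding C1_def G1_def using x
        by (auto intro!: compact_imp_closed compact_continuous_image
            continuous_on_subset[OF contc] continuous_on_subset[OF contg])
      then have "open (- (C1 \<union> G1))" by (intro open_Compl closed_Un)
      moreover have "c y \<noteq> z" "g y \<noteq> z" if "y \<in> {1/2..x}" for y
        using simple_loop_inj[OF c(1), of 0 y] simple_loop_inj[OF g(1), of 0 y] ends0 that x by auto
      then have "z \<notin> C1" "z \<notin> G1" by (force simp: C1_def G1_def)+
      then have "z \<in> - (C1 \<union> G1)" by blast
      ultimately obtain K where K: "connected K" "K \<subseteq> - (C1 \<union> G1)"
        "K \<inter> B2 = {}" "K \<inter> A2 = {}" "K \<inter> \<beta> ` {0..<r} \<noteq> {}" "K \<inter> \<alpha> ` {0..<s} \<noteq> {}"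
        unfolding B2_def A2_def
        using crossing_corner[OF crz \<beta>(1) r01 r(2) \<alpha>(1) s01 s(2)] by metis
      have "\<beta> ` {0..<r} \<subseteq> B1" "\<alpha> ` {0..<s} \<subseteq> A1" unfolding B1_def A1_def by (auto intro!: image_mono)
      then have "K \<inter> path_image c \<noteq> {}" "K \<inter> path_image g \<noteq> {}" unfolding c g using K(5,6) by blast+
      moreover have "K \<inter> c ` {0..x} = {}" "K \<inter> g ` {0..x} = {}" using cg K(2-4) by blast+
      ultimately show ?thesis using K(1) by blast
    qed
  qed
  show ?thesis using p_noncrossing by (simp add: p_def)
qed

section \<open>Idempotency of the adjacency matrix\<close>

theorem theorem5:
  fixes G :: ugraph
  assumes "is_meander_graph G"
  shows "adjacency_matrix G ^\<^sub>m 2 = adjacency_matrix G"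
proof -
  obtain n a b \<gamma> where om: "open_meander n a b \<gamma>" "closable a b \<gamma>"
    and G: "G = meander_graph_of n a b \<gamma>"
    using assms by (auto simp: is_meander_graph_def)
  define p where "p = meandric_permutation n a b \<gamma>"
  interpret noncrossing_permutation n p
    unfolding p_def by (rule meandric_permutation_noncrossing[OF om])
  have less_edge: "{i, j} \<in> snd G \<longleftrightarrow> p i < p j" if ij: "i < j" "j \<le> 2 * n" for i j
  proof -
    have "{i, j} \<in> {{0, k} |k. 1 \<le> k \<and> k \<le> 2 * n} \<longleftrightarrow> i = 0"
      using ij by (auto simp: doubleton_eq_iff)
    moreover have "{i, j} \<in> {{i, j} |i j. (i, j) \<in> non_inversions n p} \<longleftrightarrow> (i, j) \<in> non_inversions n p"
      using ij(1) by (fastforce simp: doubleton_eq_iff non_inversions_def)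
    ultimately have "{i, j} \<in> snd G \<longleftrightarrow> i = 0 \<or> (i, j) \<in> non_inversions n p"
      unfolding G meander_graph_of_def p_def by simp
    moreover have "p 0 < p j" using p_eq[of j 0] ij p_first by simp
    ultimately show ?thesis using ij by (auto simp: non_inversions_def)
  qed
  have edge: "{i, j} \<in> snd G \<longleftrightarrow> i \<noteq> j \<and> (i < j \<longleftrightarrow> p i < p j)" if ij: "i \<le> 2 * n" "j \<le> 2 * n" for i j
  proof (cases i j rule: linorder_cases)
    case less
    then show ?thesis using less_edge[OF less ij(2)] by simp
  next
    case equal
    then show ?thesis by (auto simp: G meander_graph_of_def non_inversions_def doubleton_eq_iff)
  next
    case greater
    then have "p j \<noteq> p i" using p_eq[of i j] ij by auto
    then show ?thesis using less_edge[OF greater ij(1)] greater by (auto simp: insert_commute)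
  qed
  have card: "card (fst G) = 2 * n + 1" by (simp add: G meander_graph_of_def)
  define M where "M = adjacency_matrix G"
  have dim: "M \<in> carrier_mat (2 * n + 1) (2 * n + 1)"
    by (simp add: M_def adjacency_matrix_def card)
  have M: "M $$ (i, j) = noninv p i j" if "i \<le> 2 * n" "j \<le> 2 * n" for i j
    using that edge[OF that] by (simp add: M_def adjacency_matrix_def card noninv_def)
  have "M * M = M"
  proof (rule eq_matI)
    fix i j assume "i < dim_row M" "j < dim_col M"
    then have ij: "i \<le> 2 * n" "j \<le> 2 * n" using dim by auto
    have "(M * M) $$ (i, j) = (\<Sum>l\<in>{0..<2 * n + 1}. M $$ (i, l) * M $$ (l, j))"
      using dim ij by (auto simp: times_mat_def scalar_prod_def simp del: mult_bit_eq_and intro!: sum.cong)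
    also have "\<dots> = (\<Sum>l\<in>{0..2 * n}. noninv p i l * noninv p l j)"
      using ij M by (intro sum.cong) auto
    also have "\<dots> = M $$ (i, j)" using noninv_idempotent[OF ij] M ij by simp
    finally show "(M * M) $$ (i, j) = M $$ (i, j)" .
  qed (use dim in auto)
  then show ?thesis using dim by (simp add: numeral_2_eq_2 flip: M_def)
qed

end
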